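(* Let $r\ge 0$ be an integer. If $G$ is a $B_{r+1}$-free graph with $m\ge 1$ edges, where $m\ge (4r)^2$, then $$\lambda(G)\le \sqrt m,$$ with equality if and only if $G$ is a complete bipartite graph (up to isolated vertices).
   Context: Graphs are finite and simple. $\lambda(G)$ is the largest eigenvalue of the adjacency matrix of $G$. $B_k$ (the book of size $k$) is the graph consisting of $k$ triangles sharing a common edge. A graph is $B_{r+1}$-free if it contains no copy of $B_{r+1}$ as a (not necessarily induced) subgraph. Isolated vertices are ignored in all extremal and equality statements. *)

theory Defs
  imports "Jordan_Normal_Form.Spectral_Radius"
begin

text \<open>A graph is a pair of a vertex set and a set of edges, where an edge is the set of its two
  end points.\<close>

type_synonym 'a graph = "'a set \<times> 'a set set"

abbreviation verts :: "'a graph \<Rightarrow> 'a set" where "verts G \<equiv> fst G"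
abbreviation edges :: "'a graph \<Rightarrow> 'a set set" where "edges G \<equiv> snd G"

definition simple_graph :: "'a graph \<Rightarrow> bool" where
  "simple_graph G \<longleftrightarrow> finite (verts G) \<and> (\<forall>e\<in>edges G. e \<subseteq> verts G \<and> card e = 2)"

text \<open>A (not necessarily induced) copy of \<open>H\<close> in \<open>G\<close> is an injective image of \<open>H\<close>.\<close>

definition contains_copy :: "'a graph \<Rightarrow> 'b graph \<Rightarrow> bool" where
  "contains_copy G H \<longleftrightarrow>
     (\<exists>f. inj_on f (verts H) \<and> f ` verts H \<subseteq> verts G \<and> (\<forall>e\<in>edges H. f ` e \<in> edges G))"

definition free_of :: "'b graph \<Rightarrow> 'a graph \<Rightarrow> bool" where
  "free_of H G \<longleftrightarrow> \<not> contains_copy G H"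

text \<open>The common edge of the \<open>k\<close> triangles is \<open>{0, 1}\<close>; their apexes are \<open>2, \<dots>, k + 1\<close>.\<close>

definition book :: "nat \<Rightarrow> nat graph" where
  "book k = ({..<k + 2}, insert {0, 1} (\<Union>i\<in>{2..<k + 2}. {{0, i}, {1, i}}))"

definition complete_bipartite :: "'a graph \<Rightarrow> bool" where
  "complete_bipartite G \<longleftrightarrow>
     (\<exists>A B. A \<noteq> {} \<and> B \<noteq> {} \<and> A \<inter> B = {} \<and> verts G = A \<union> B \<and> edges G = {{a, b} | a b. a \<in> A \<and> b \<in> B})"

definition remove_isolated :: "'a graph \<Rightarrow> 'a graph" where
  "remove_isolated G = ({v \<in> verts G. \<exists>e\<in>edges G. v \<in> e}, edges G)"

text \<open>Matrices are indexed by numbers, so the adjacency matrix depends on an ordering \<open>vs\<close> of the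
  vertices. Its diagonal vanishes because singletons are not edges of a simple graph.\<close>

definition adjacency_matrix :: "'a list \<Rightarrow> 'a graph \<Rightarrow> real mat" where
  "adjacency_matrix vs G =
     mat (length vs) (length vs) (\<lambda>(i, j). if {vs ! i, vs ! j} \<in> edges G then 1 else 0)"

definition vertex_ordering :: "'a graph \<Rightarrow> 'a list" where
  "vertex_ordering G = (SOME vs. distinct vs \<and> set vs = verts G)"

text \<open>The adjacency matrix is symmetric, so the maximum over its real spectrum is the maximum over
  all its eigenvalues. It does not depend on the ordering, as shown by
  \<open>max_eigenvalue_eq\<close> below.\<close>

definition max_eigenvalue :: "'a graph \<Rightarrow> real" where
  "max_eigenvalue G = Max (spectrum (adjacency_matrix (vertex_ordering G) G))"

lemma vertex_ordering:
  assumes "finite (verts G)"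
  shows "distinct (vertex_ordering G)" "set (vertex_ordering G) = verts G"
proof -
  have "\<exists>vs. distinct vs \<and> set vs = verts G"
    using finite_distinct_list[OF assms] by blast
  from someI_ex[OF this] show "distinct (vertex_ordering G)" "set (vertex_ordering G) = verts G"
    by (simp_all add: vertex_ordering_def)
qed

lemma eigenvalue_adjacency_matrix_iff:
  assumes d: "distinct vs"
  shows "eigenvalue (adjacency_matrix vs G) k \<longleftrightarrow>
    (\<exists>x. (\<exists>v\<in>set vs. x v \<noteq> 0) \<and>
         (\<forall>v\<in>set vs. (\<Sum>u\<in>set vs. (if {v, u} \<in> edges G then 1 else 0) * x u) = k * x v))"
proof -
  let ?n = "length vs" and ?A = "adjacency_matrix vs G"
  let ?a = "\<lambda>v u. (if {v, u} \<in> edges G then 1 else 0) :: real"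
  have bij: "bij_betw ((!) vs) {0..<?n} (set vs)"
    using bij_betw_nth[OF d, of "{0..<?n}" "set vs"] by (simp add: lessThan_atLeast0)
  have row: "(?A *\<^sub>v y) $ i = (\<Sum>j = 0..<?n. ?a (vs ! i) (vs ! j) * y $ j)"
    if "y \<in> carrier_vec ?n" "i < ?n" for y i
    using that by (simp add: adjacency_matrix_def mult_mat_vec_def scalar_prod_def)
  have dim: "dim_row ?A = ?n" by (simp add: adjacency_matrix_def)
  show ?thesis
  proof
    assume "eigenvalue ?A k"
    then obtain y where y: "y \<in> carrier_vec ?n" "y \<noteq> 0\<^sub>v ?n" "?A *\<^sub>v y = k \<cdot>\<^sub>v y"
      unfolding eigenvalue_def eigenvector_def dim by blast
    define x where "x v = y $ the_inv_into {0..<?n} ((!) vs) v" for v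
    have x: "x (vs ! i) = y $ i" if "i < ?n" for i
      using that bij by (simp add: x_def bij_betw_def the_inv_into_f_f)
    have "\<exists>i<?n. y $ i \<noteq> 0"
      using y(1,2) by (metis carrier_vecD eq_vecI index_zero_vec)
    then have 1: "\<exists>v\<in>set vs. x v \<noteq> 0" using x nth_mem by metis
    have 2: "(\<Sum>u\<in>set vs. ?a v u * x u) = k * x v" if v: "v \<in> set vs" for v
    proof -
      obtain i where i: "i < ?n" "v = vs ! i" using v by (metis in_set_conv_nth)
      have "(\<Sum>u\<in>set vs. ?a v u * x u) = (\<Sum>j = 0..<?n. ?a v (vs ! j) * x (vs ! j))"
        using sum.reindex_bij_betw[OF bij, of "\<lambda>u. ?a v u * x u"] by simp
      also have "\<dots> = (?A *\<^sub>v y) $ i"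
        unfolding row[OF y(1) i(1)] i(2) by (intro sum.cong) (auto simp: x)
      also have "\<dots> = k * x v" using y i x by simp
      finally show ?thesis .
    qed
    show "\<exists>x. (\<exists>v\<in>set vs. x v \<noteq> 0) \<and> (\<forall>v\<in>set vs. (\<Sum>u\<in>set vs. ?a v u * x u) = k * x v)"
      using 1 2 by blast
  next
    assume "\<exists>x. (\<exists>v\<in>set vs. x v \<noteq> 0) \<and> (\<forall>v\<in>set vs. (\<Sum>u\<in>set vs. ?a v u * x u) = k * x v)"
    then obtain x where x: "\<exists>v\<in>set vs. x v \<noteq> 0"
      "\<And>v. v \<in> set vs \<Longrightarrow> (\<Sum>u\<in>set vs. ?a v u * x u) = k * x v" by blast
    define y where "y = vec ?n (\<lambda>i. x (vs ! i))"
    have y: "y \<in> carrier_vec ?n" by (simp add: y_def)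
    have "y \<noteq> 0\<^sub>v ?n"
    proof
      assume "y = 0\<^sub>v ?n"
      then have "x (vs ! i) = 0" if "i < ?n" for i
        using that by (metis index_vec index_zero_vec(1) y_def)
      then show False using x(1) by (metis in_set_conv_nth)
    qed
    moreover have "?A *\<^sub>v y = k \<cdot>\<^sub>v y"
    proof (rule eq_vecI)
      show "dim_vec (?A *\<^sub>v y) = dim_vec (k \<cdot>\<^sub>v y)" by (simp add: dim y_def)
      fix i assume "i < dim_vec (k \<cdot>\<^sub>v y)"
      then have i: "i < ?n" by (simp add: y_def)
      have "(?A *\<^sub>v y) $ i = (\<Sum>j = 0..<?n. ?a (vs ! i) (vs ! j) * x (vs ! j))"
        unfolding row[OF y i] by (intro sum.cong) (auto simp: y_def)
      also have "\<dots> = (\<Sum>u\<in>set vs. ?a (vs ! i) u * x u)"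
        using sum.reindex_bij_betw[OF bij, of "\<lambda>u. ?a (vs ! i) u * x u"] by simp
      also have "\<dots> = k * x (vs ! i)" using i by (intro x(2)) simp
      finally show "(?A *\<^sub>v y) $ i = (k \<cdot>\<^sub>v y) $ i" using i by (simp add: y_def)
    qed
    ultimately show "eigenvalue ?A k"
      unfolding eigenvalue_def eigenvector_def dim using y by blast
  qed
qed

lemma max_eigenvalue_eq:
  assumes "distinct vs" "set vs = verts G"
  shows "max_eigenvalue G = Max (spectrum (adjacency_matrix vs G))"
proof -
  have "finite (verts G)" using assms(2) by (metis List.finite_set)
  note vo = vertex_ordering[OF this]
  have "eigenvalue (adjacency_matrix (vertex_ordering G) G) = eigenvalue (adjacency_matrix vs G)"
    by (rule ext)
      (simp only: eigenvalue_adjacency_matrix_iff[OF assms(1)]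
        eigenvalue_adjacency_matrix_iff[OF vo(1)] assms(2) vo(2))
  then show ?thesis by (simp add: max_eigenvalue_def spectrum_def)
qed

end

theory Submission
  imports Defs "HOL-Analysis.Function_Topology"
begin

text \<open>Put \<open>n = sqrt m\<close>, let \<open>\<lambda>\<close> be the largest eigenvalue and assume \<open>\<lambda> \<ge> n\<close>. Scale the non-negative
  eigenvector \<open>x\<close> so that \<open>\<Sum> (x u)\<^sup>2 = 2 n\<close>; in a complete bipartite graph every edge \<open>u v\<close> then has
  \<open>x u * x v = 1\<close>. For an edge write \<open>\<eta> = x u * x v\<close>, let \<open>C\<close> be the weight (sum of the squares \<open>(x w)\<^sup>2\<close>)
  of its common neighbours, and \<open>S\<close> the weight of the vertices adjacent to neither end. The weights
  of the two neighbourhoods add up to \<open>2 n + C - S\<close>. Combining this with two variances, that of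
  the neighbourhood weights around \<open>n\<close> and that of \<open>\<eta>\<close> around \<open>1\<close>, gives \<open>weighted_count\<close>:
  the sum of \<open>2 n (\<eta> - 1)\<^sup>2 + \<eta>\<^sup>2 (S - C)\<close> over the ordered edges is at most \<open>8 n\<^sup>2 (n - \<lambda>)\<close>.

  In a triangle-free graph \<open>C = 0\<close> and all terms are non-negative, so \<open>\<lambda> = n\<close>, every \<open>\<eta>\<close> is \<open>1\<close>
  and every \<open>S\<close> vanishes; the last condition says that the two neighbourhoods of an edge cover all
  non-isolated vertices, which makes the graph complete bipartite. It remains to show that triangles
  make the sum positive.

  Every vertex is adjacent to both ends or to no end of some edge of a given triangle, so the
  three values of \<open>S + C\<close> on a triangle add up to at least \<open>2 n\<close> (\<open>triangle_cover\<close>). An edge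
  lies in at most \<open>r \<le> n / 4\<close> triangles, so it can hand to each of them a share \<open>8 / (2 n)\<close> of its
  term. It hands over, with the factor \<open>f\<close> (the \<open>bonus\<close>, essentially the square of
  the smallest \<open>\<eta>\<close> in the triangle), its \<open>S + C\<close>, and keeps a debt that is also split among
  its triangles (\<open>edge_excess_ge\<close>). If \<open>\<eta>\<close> is small the debt comes from \<open>(\<eta>\<^sup>2 + f) C\<close>, where Chebyshev's sum
  inequality makes the \<open>C\<close> part belonging to \<open>f\<close> local to each triangle. If \<open>\<eta>\<close> is large this would be
  too expensive, and an a priori bound is used: few triangles on each edge force every neighbourhood
  to have weight at most \<open>8 n / 7\<close> (\<open>nbr_weight_le\<close>), hence \<open>C - S \<le> 2 n / 7\<close>. The problem is
  then reduced to an inequality in the three numbers \<open>x u, x v, x w\<close> of one triangle, namely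
  \<open>triangle_charge_pos\<close>, which is strict and thus rules out triangles altogether.

  The eigenvector comes from maximising the quadratic form of the adjacency matrix over
  the unit sphere (\<open>perron_vector\<close>).\<close>

section \<open>The inequality for a single triangle\<close>

text \<open>The cap \<open>5/4\<close> keeps the bonus, and the debts proportional to it, bounded; without it the debts of a
  triangle with three large products would exceed its gains.\<close>
definition bonus :: "real \<Rightarrow> real \<Rightarrow> real \<Rightarrow> real" where
  "bonus a b c = (min (min (a * b) (a * c)) (min (b * c) (5/4)))\<^sup>2"

text \<open>The share of one triangle in the term of an edge with \<open>x u * x v = \<eta>\<close>, where \<open>t\<close> is the value of
  \<open>x\<close> at the third vertex and \<open>f\<close> the bonus of the triangle. Below \<open>7/2\<close> the
  edge is charged for the actual weight of its common neighbours, from there on for the a priori bound. The factor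
  \<open>8\<close> is the least possible value of \<open>2 n / r\<close>.\<close>
definition charge :: "real \<Rightarrow> real \<Rightarrow> real \<Rightarrow> real" where
  "charge f t \<eta> = (if \<eta> < 7/2 then 8 * (\<eta> - 1)\<^sup>2 - (\<eta>\<^sup>2 + f) * t\<^sup>2
     else 8 * ((\<eta> - 1)\<^sup>2 - \<eta>\<^sup>2 / 7 - f))"

lemma bonus_commute: "bonus b a c = bonus a b c" "bonus a c b = bonus a b c"
  by (simp_all add: bonus_def mult.commute min.commute min.left_commute min.assoc)

lemma bonus_mono: "0 \<le> a \<Longrightarrow> 0 \<le> b \<Longrightarrow> 0 \<le> c \<Longrightarrow> c \<le> c' \<Longrightarrow> bonus a b c \<le> bonus a b c'"
  unfolding bonus_def
  by (intro power_mono min.mono mult_left_mono) auto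

lemma bonus_le: "0 \<le> a \<Longrightarrow> 0 \<le> b \<Longrightarrow> 0 \<le> c \<Longrightarrow> bonus a b c \<le> (a * b)\<^sup>2"
  unfolding bonus_def by (intro power_mono) auto

lemma bonus_nonneg: "0 \<le> bonus a b c"
  by (simp add: bonus_def)

text \<open>This and the next lemma are what remains of the light case after all variables but \<open>p\<close>, the smallest
  product, have been optimised. Each is proved by completing a square near the minimum of the
  difference of the two sides; \<open>p \<le> 5/4\<close> separates the two forms of the bonus.\<close>
lemma poly_small:
  fixes p :: real assumes "0 \<le> p" "p \<le> 5/4"
  shows "(p\<^sup>2 + (1 - p)\<^sup>2 - p\<^sup>2 * p / 4 + 2) * (16 - 3 * p - p) > 32"
proof -
  have "(p\<^sup>2 + (1 - p)\<^sup>2 - p\<^sup>2 * p / 4 + 2) * (16 - 3 * p - p) - 32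
    = 4 * ((p - 83/100)\<^sup>2 * (p\<^sup>2 / 4 + (221467/40000 - 517/200 * p))
        + (74313837/400000000 - 28313/1000000 * p))"
    by (simp add: field_simps power2_eq_square)
  also have "\<dots> > 0"
    using assms by (intro mult_pos_pos add_nonneg_pos mult_nonneg_nonneg add_nonneg_nonneg) auto
  finally show ?thesis by simp
qed

lemma poly_large:
  fixes p e :: real assumes "5/4 \<le> p" "p \<le> 7/2" "e \<le> 5/4"
  shows "(25/16 + (1 - p)\<^sup>2 - 25/16 * p / 4 + 2) * (16 - 3 * p - e) > 32"
proof -
  let ?X = "25/16 + (1 - p)\<^sup>2 - 25/16 * p / 4 + 2"
  have "?X * ((59 - 12 * p) / 4) - 32
    = ((p - 7/4)\<^sup>2 * (731/16 - 12 * p) + (325/256 + 55/64 * p)) / 4"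
    by (simp add: field_simps power2_eq_square)
  also have "\<dots> > 0"
    using assms by (intro divide_pos_pos add_nonneg_pos mult_nonneg_nonneg) auto
  finally have 1: "?X * ((59 - 12 * p) / 4) > 32" by simp
  have "0 \<le> (1 - p)\<^sup>2" by simp
  then have "?X \<ge> 0" using assms(2) by linarith
  then have "?X * ((59 - 12 * p) / 4) \<le> ?X * (16 - 3 * p - e)"
    using assms by (intro mult_left_mono) auto
  with 1 show ?thesis by linarith
qed

text \<open>The case without heavy products, stated for any triangle with smallest product below \<open>7/2\<close>.
  For fixed \<open>p = a b\<close> it depends on \<open>\<sigma> = c (a + b)\<close> and \<open>d = (b - a)\<^sup>2\<close>. The terms with \<open>d\<close> only help,
  as \<open>f \<le> 4 c\<^sup>2\<close>, so \<open>a = b\<close> is the worst case; the rest is a quadratic in \<open>\<sigma>\<close> with minimum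
  at \<open>32 / D\<close>.\<close>
lemma light_triangle:
  fixes a b c f :: real
  assumes "0 \<le> a" "a \<le> b" "b \<le> c" and p: "a * b < 7/2" and f: "f = (min (a * b) (5/4))\<^sup>2"
  shows "0 < 8 * f + (8 * (a * b - 1)\<^sup>2 - ((a * b)\<^sup>2 + f) * c\<^sup>2)
    + (8 * (a * c - 1)\<^sup>2 - ((a * c)\<^sup>2 + f) * b\<^sup>2) + (8 * (b * c - 1)\<^sup>2 - ((b * c)\<^sup>2 + f) * a\<^sup>2)"
    (is "0 < ?E")
proof (cases "a = 0")
  case True
  then show ?thesis using f by (simp add: add_pos_nonneg)
next
  case False
  define p where "p = a * b"
  define e where "e = f / p"
  define \<sigma> where "\<sigma> = c * (a + b)"
  define d where "d = (b - a)\<^sup>2"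
  define D where "D = 16 - 3 * p - e"
  have pos: "0 < p" using False assms by (simp add: p_def)
  have fe: "f = e * p" using pos by (simp add: e_def)
  have e: "0 \<le> e" "e \<le> 5/4" "p \<le> 5/4 \<Longrightarrow> e = p"
    using pos f by (auto simp: e_def p_def[symmetric] min_def power2_eq_square divide_le_eq)
  have pc: "p \<le> c\<^sup>2" unfolding p_def power2_eq_square using assms by (intro mult_mono) auto
  have "e * p \<le> (5/4) * c\<^sup>2" using e pos pc by (intro mult_mono) auto
  moreover have "0 \<le> c\<^sup>2" by simp
  ultimately have "e * p / 8 \<le> c\<^sup>2 / 2" by linarith
  then have df: "d * (f / 8) \<le> d * (c\<^sup>2 / 2)"
    unfolding fe by (intro mult_left_mono) (auto simp: d_def)
  have \<sigma>: "p * c\<^sup>2 = (\<sigma>\<^sup>2 - c\<^sup>2 * d) / 4"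
    unfolding p_def \<sigma>_def d_def by (simp add: power2_eq_square algebra_simps)
  have "?E = 8 * f + 8 * (1 - p)\<^sup>2 + 8 * ((a * c - 1)\<^sup>2 + (b * c - 1)\<^sup>2) - 3 * p * (p * c\<^sup>2)
      - f * (a\<^sup>2 + b\<^sup>2 + c\<^sup>2)"
    unfolding p_def by (simp add: power2_eq_square algebra_simps)
  also have "(a * c - 1)\<^sup>2 + (b * c - 1)\<^sup>2 = (\<sigma> - 2)\<^sup>2 / 2 + c\<^sup>2 * d / 2"
    unfolding \<sigma>_def d_def by (simp add: field_simps power2_eq_square)
  also have "f * (a\<^sup>2 + b\<^sup>2 + c\<^sup>2) = 2 * (f * p) + f * d + e * (p * c\<^sup>2)"
    unfolding fe p_def d_def by (simp add: power2_eq_square algebra_simps)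
  also have "8 * f + 8 * (1 - p)\<^sup>2 + 8 * ((\<sigma> - 2)\<^sup>2 / 2 + c\<^sup>2 * d / 2) - 3 * p * (p * c\<^sup>2)
      - (2 * (f * p) + f * d + e * (p * c\<^sup>2))
    = 8 * (f + (1 - p)\<^sup>2 + (\<sigma> - 2)\<^sup>2 / 2 - 3/32 * p * \<sigma>\<^sup>2 - f * p / 4 - e * \<sigma>\<^sup>2 / 32
      + (d * (c\<^sup>2 / 2) - d * (f / 8)) + 3/32 * p * c\<^sup>2 * d + e * c\<^sup>2 * d / 32)"
    unfolding \<sigma> by (simp add: field_simps)
  finally have E: "?E = \<dots>" .
  have "X \<le> 8 * (X + (B - A) + C + F) / 8" if "A \<le> B" "0 \<le> C" "0 \<le> F" for X A B C F :: real
    using that by simp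
  note gen = this
  have 1: "?E / 8 \<ge> f + (1 - p)\<^sup>2 + (\<sigma> - 2)\<^sup>2 / 2 - 3/32 * p * \<sigma>\<^sup>2 - f * p / 4 - e * \<sigma>\<^sup>2 / 32"
    unfolding E by (rule gen[OF df]) (use pos e in \<open>auto simp: d_def\<close>)
  have D: "0 < D" using p e by (simp add: D_def p_def)
  have "f + (1 - p)\<^sup>2 + (\<sigma> - 2)\<^sup>2 / 2 - 3/32 * p * \<sigma>\<^sup>2 - f * p / 4 - e * \<sigma>\<^sup>2 / 32
    = f + (1 - p)\<^sup>2 - f * p / 4 + 2 + (D / 32 * \<sigma>\<^sup>2 - 2 * \<sigma>)"
    unfolding D_def power2_diff by (simp add: field_simps)
  also have "D / 32 * \<sigma>\<^sup>2 - 2 * \<sigma> = D / 32 * (\<sigma> - 32 / D)\<^sup>2 - 32 / D"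
    using D by (simp add: power2_diff power_divide power2_eq_square diff_divide_distrib right_diff_distrib ring_distribs)
  finally have sq: "f + (1 - p)\<^sup>2 + (\<sigma> - 2)\<^sup>2 / 2 - 3/32 * p * \<sigma>\<^sup>2 - f * p / 4 - e * \<sigma>\<^sup>2 / 32
    = f + (1 - p)\<^sup>2 - f * p / 4 + 2 + (D / 32 * (\<sigma> - 32 / D)\<^sup>2 - 32 / D)" .
  have "X + (Y - Z) \<le> W \<Longrightarrow> 0 \<le> Y \<Longrightarrow> X - Z \<le> W" for X Y Z W :: real by simp
  from this[OF 1[unfolded sq]] have 2: "?E / 8 \<ge> f + (1 - p)\<^sup>2 - f * p / 4 + 2 - 32 / D"
    using D by simp
  have "(f + (1 - p)\<^sup>2 - f * p / 4 + 2) * D > 32"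
  proof (cases "p \<le> 5/4")
    case True
    then have "e = p" "f = p\<^sup>2" using e fe by (auto simp: power2_eq_square)
    then show ?thesis using poly_small[of p] pos True by (simp add: D_def)
  next
    case False
    then have "f = 25/16" by (simp add: f p_def[symmetric] power2_eq_square)
    then show ?thesis unfolding D_def
      by (simp only:) (rule poly_large, use False p e in \<open>auto simp: p_def\<close>)
  qed
  then have 3: "32 / D < f + (1 - p)\<^sup>2 - f * p / 4 + 2" using D by (simp add: divide_less_eq)
  have "X - Z \<le> W / 8 \<Longrightarrow> Z < X \<Longrightarrow> 0 < W" for X Z W :: real by linarith
  from this[OF 2 3] show ?thesis .
qed

text \<open>A product is called heavy if it is at least \<open>7/2\<close>. The term \<open>6/7 * s\<^sup>2 - 2 * s + 1\<close> is \<open>(s - 1)\<^sup>2 - s\<^sup>2 / 7\<close>.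
  The expression increases with the heavy product \<open>s\<close>, so \<open>s = 7/2\<close> is the worst case.\<close>
lemma one_heavy:
  fixes p q s :: real
  assumes "0 \<le> p" "p \<le> q" "q < 7/2" "7/2 \<le> s"
  shows "8 * (1 - p)\<^sup>2 + 8 * (1 - q)\<^sup>2 - 2 * p * q * s - 5/4 * q * s - 25/16 * s
    + 8 * (6/7 * s\<^sup>2 - 2 * s + 1) > 0" (is "?E s > 0")
proof -
  have pq: "2 * p * q \<le> 49/2" using mult_mono[of p "7/2" q "7/2"] assms by simp
  have "?E s - ?E (7/2) = (s - 7/2) * (48/7 * (s - 7/2) + (32 - 2 * p * q - 5/4 * q - 25/16))"
    by (simp add: field_simps power2_eq_square)
  moreover have "\<dots> \<ge> 0" using pq assms by (intro mult_nonneg_nonneg add_nonneg_nonneg) auto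
  moreover have "?E (7/2) = 9/2 * (p - 16/9)\<^sup>2 + 9/2 * (q - 163/72)\<^sup>2 + 7/2 * (p - q)\<^sup>2
      + (16 + 36 - 175/32 - 9/2 * (16/9)\<^sup>2 - 9/2 * (163/72)\<^sup>2)"
    by (simp add: field_simps power2_eq_square)
  moreover have "16 + 36 - 175/32 - 9/2 * (16/9)\<^sup>2 - 9/2 * (163/72)\<^sup>2 > (0::real)"
    by (simp add: power2_eq_square)
  moreover have "9/2 * (p - 16/9)\<^sup>2 \<ge> 0" "9/2 * (q - 163/72)\<^sup>2 \<ge> 0" "7/2 * (p - q)\<^sup>2 \<ge> 0" by auto
  ultimately show ?thesis by linarith
qed

text \<open>After \<open>2 q s\<close> is replaced by \<open>q\<^sup>2 + s\<^sup>2\<close> the heavy products separate, and both may be taken to be \<open>7/2\<close>.\<close>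
lemma two_heavy:
  fixes p q s :: real
  assumes "0 \<le> p" "p < 7/2" "7/2 \<le> q" "7/2 \<le> s"
  shows "8 * (1 - p)\<^sup>2 - p * q * s - 5/4 * q * s - 25/2
    + 8 * (6/7 * q\<^sup>2 - 2 * q + 1) + 8 * (6/7 * s\<^sup>2 - 2 * s + 1) > 0" (is "?E > 0")
proof -
  define k where "k = 48/7 - (p + 5/4) / 2"
  have k: "k \<ge> 4" using assms by (simp add: k_def field_simps)
  have *: "k * x\<^sup>2 - 16 * x \<ge> k * (49/4) - 56" if "x \<ge> 7/2" for x
  proof -
    have "k * x\<^sup>2 - 16 * x - (k * (49/4) - 56) = (x - 7/2) * (k * (x - 7/2) + (7 * k - 16))" by (simp add: field_simps power2_eq_square)
    also have "\<dots> \<ge> 0" using that k by (intro mult_nonneg_nonneg add_nonneg_nonneg) auto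
    finally show ?thesis by simp
  qed
  define T where "T = (p + 5/4) / 2 * (q - s)\<^sup>2"
  define Q where "Q = (\<lambda>x. k * x\<^sup>2 - 16 * x)"
  have T: "T \<ge> 0" using assms by (simp add: T_def)
  have Q: "Q q \<ge> k * (49/4) - 56" "Q s \<ge> k * (49/4) - 56" using * assms by (auto simp: Q_def)
  have "0 < 8 * (p - 113/64)\<^sup>2 + 13951/512" by (simp add: add_nonneg_pos)
  also have "8 * (p - 113/64)\<^sup>2 + 13951/512 = 8 * (1 - p)\<^sup>2 + 2 * (k * (49/4) - 56) + 16 - 25/2"
    unfolding k_def by (simp add: field_simps power2_eq_square)
  also have "\<dots> \<le> 8 * (1 - p)\<^sup>2 + T + Q q + Q s + 16 - 25/2" using T add_mono[OF Q] by simp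
  also have "\<dots> = ?E" unfolding k_def T_def Q_def by (simp add: field_simps power2_eq_square)
  finally show ?thesis .
qed

text \<open>The largest product is the first to become heavy, so the number of heavy products determines which
  ones they are. With exactly one, its own debt \<open>8 f\<close> cancels the triangle's gain \<open>8 f\<close>.\<close>
lemma triangle_sorted:
  fixes a b c f :: real
  assumes o: "0 \<le> a" "a \<le> b" "b \<le> c" and f: "f = (min (a * b) (5/4))\<^sup>2"
  shows "0 < 8 * f + charge f c (a * b) + charge f b (a * c) + charge f a (b * c)"
proof -
  have pq: "0 \<le> a * b" "a * b \<le> a * c" "a * c \<le> b * c" using o by (auto intro: mult_mono)
  have f1: "f \<le> 25/16" unfolding f using pq power_mono[of "min (a * b) (5/4)" "5/4" 2]
    by (simp add: power2_eq_square)
  have f2: "f \<le> 5/4 * (a * b)" unfolding f power2_eq_square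
    using pq mult_mono[of "min (a * b) (5/4)" "5/4" "min (a * b) (5/4)" "a * b"] by simp
  have f0: "0 \<le> f" by (simp add: f)
  have fc: "f * c\<^sup>2 \<le> 5/4 * (a * c) * (b * c)"
    using mult_right_mono[OF f2, of "c\<^sup>2"] by (simp add: power2_eq_square algebra_simps)
  have "b\<^sup>2 \<le> b * c" using o by (simp add: power2_eq_square mult_left_mono)
  then have fb: "f * b\<^sup>2 \<le> 25/16 * (b * c)" using f1 f0 o by (intro mult_mono) auto
  have hpos: "8 * (6/7 * x\<^sup>2 - 2 * x + 1) \<ge> 36" if "x \<ge> 7/2" for x :: real
  proof -
    have "8 * (6/7 * x\<^sup>2 - 2 * x + 1) - 36 = (x - 7/2) * (48/7 * (x - 7/2) + 32)" by (simp add: field_simps power2_eq_square)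
    also have "\<dots> \<ge> 0" using that by (intro mult_nonneg_nonneg add_nonneg_nonneg) auto
    finally show ?thesis by simp
  qed
  consider "b * c < 7/2" | "a * c < 7/2" "7/2 \<le> b * c" | "a * b < 7/2" "7/2 \<le> a * c" | "7/2 \<le> a * b"
    by linarith
  then show ?thesis
  proof cases
    case 1
    then show ?thesis using light_triangle[OF o _ f] pq by (simp add: charge_def)
  next
    case 2
    have "8 * f + charge f c (a * b) + charge f b (a * c) + charge f a (b * c)
      = 8 * (1 - a * b)\<^sup>2 + 8 * (1 - a * c)\<^sup>2 - 2 * (a * b) * (a * c) * (b * c) - f * c\<^sup>2 - f * b\<^sup>2
        + 8 * (6/7 * (b * c)\<^sup>2 - 2 * (b * c) + 1)"
      using 2 pq by (simp add: charge_def field_simps power2_eq_square)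
    then show ?thesis using one_heavy[OF pq(1,2) 2] fb fc by linarith
  next
    case 3
    have "8 * f + charge f c (a * b) + charge f b (a * c) + charge f a (b * c)
      = 8 * (1 - a * b)\<^sup>2 - (a * b) * (a * c) * (b * c) - f * c\<^sup>2 - 8 * f
        + 8 * (6/7 * (a * c)\<^sup>2 - 2 * (a * c) + 1) + 8 * (6/7 * (b * c)\<^sup>2 - 2 * (b * c) + 1)"
      using 3 pq by (simp add: charge_def field_simps power2_eq_square)
    then show ?thesis using two_heavy[OF pq(1) 3, of "b * c"] 3 pq fc f1 by linarith
  next
    case 4
    have "8 * f + charge f c (a * b) + charge f b (a * c) + charge f a (b * c)
      = 8 * (6/7 * (a * b)\<^sup>2 - 2 * (a * b) + 1)
        + 8 * (6/7 * (a * c)\<^sup>2 - 2 * (a * c) + 1) + 8 * (6/7 * (b * c)\<^sup>2 - 2 * (b * c) + 1) - 16 * f"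
      using 4 pq by (simp add: charge_def field_simps power2_eq_square)
    then show ?thesis using hpos[of "a * b"] hpos[of "a * c"] hpos[of "b * c"] 4 pq f1 by linarith
  qed
qed

text \<open>The statement is symmetric in the three vertices, which allows them to be sorted.\<close>
lemma triangle_charge_pos:
  fixes a b c :: real
  assumes "0 \<le> a" "0 \<le> b" "0 \<le> c"
  defines "f \<equiv> bonus a b c"
  shows "0 < 8 * f + charge f c (a * b) + charge f b (a * c) + charge f a (b * c)"
proof -
  define P where "P x y z \<longleftrightarrow> 0 < 8 * bonus x y z + charge (bonus x y z) z (x * y)
    + charge (bonus x y z) y (x * z) + charge (bonus x y z) x (y * z)" for x y z
  have sorted: "P x y z" if "0 \<le> x" "x \<le> y" "y \<le> z" for x y z
  proof -
    have "x * y \<le> x * z" "x * y \<le> y * z" using that by (auto simp: mult.commute intro: mult_mono)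
    then have "bonus x y z = (min (x * y) (5/4))\<^sup>2" by (simp add: bonus_def min_def)
    then show ?thesis unfolding P_def using that by (intro triangle_sorted) auto
  qed
  have sym: "P x y z = P y x z" "P x y z = P x z y" for x y z
    unfolding P_def by (simp_all add: bonus_commute mult.commute add.commute add.left_commute add.assoc)
  have "P a b c" using sorted sym assms(1-3) by (metis linorder_linear)
  then show ?thesis by (simp add: P_def f_def)
qed

section \<open>Weighted counting with the principal eigenvector\<close>

text \<open>Chebyshev's sum inequality with weights \<open>c\<close>: expand the sum of
  \<open>c i * c j * ((f i - f j) * (g i - g j))\<close>.\<close>
lemma chebyshev_sum:
  fixes c f g :: "'a \<Rightarrow> real"
  assumes c: "\<And>i. i \<in> I \<Longrightarrow> 0 \<le> c i"
    and mono: "\<And>i j. i \<in> I \<Longrightarrow> j \<in> I \<Longrightarrow> 0 \<le> (f i - f j) * (g i - g j)"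
  shows "(\<Sum>i\<in>I. c i * f i) * (\<Sum>i\<in>I. c i * g i) \<le> (\<Sum>i\<in>I. c i) * (\<Sum>i\<in>I. c i * (f i * g i))"
proof -
  let ?S = "\<Sum>i\<in>I. \<Sum>j\<in>I. c i * c j * ((f i - f j) * (g i - g j))"
  have "0 \<le> ?S" using c mono by (intro sum_nonneg mult_nonneg_nonneg[OF mult_nonneg_nonneg]) auto
  also have "?S = (\<Sum>i\<in>I. \<Sum>j\<in>I. (c i * (f i * g i)) * c j) - (\<Sum>i\<in>I. \<Sum>j\<in>I. (c i * f i) * (c j * g j))
      - (\<Sum>i\<in>I. \<Sum>j\<in>I. (c i * g i) * (c j * f j)) + (\<Sum>i\<in>I. \<Sum>j\<in>I. c i * (c j * (f j * g j)))"
    by (simp add: sum_subtractf[symmetric] sum.distrib[symmetric] algebra_simps)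
  also have "\<dots> = 2 * ((\<Sum>i\<in>I. c i) * (\<Sum>i\<in>I. c i * (f i * g i))
      - (\<Sum>i\<in>I. c i * f i) * (\<Sum>i\<in>I. c i * g i))"
    unfolding sum_product[symmetric] by (simp add: algebra_simps)
  finally show ?thesis by simp
qed

text \<open>Here \<open>n\<close> is the square root of the number of edges and \<open>l\<close> the eigenvalue. The normalisation of \<open>x\<close>
  makes \<open>1\<close> the value of \<open>x u * x v\<close> on the edges of an extremal graph. The last
  assumption is the only trace of the forbidden book: an edge lies in at most \<open>n / 4\<close> triangles.\<close>
locale principal_eigenvector =
  fixes V :: "'a set" and adj :: "'a \<Rightarrow> 'a \<Rightarrow> bool" and x :: "'a \<Rightarrow> real" and n l :: real
  assumes fin: "finite V" and adj_sym: "adj u v \<Longrightarrow> adj v u"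
    and nonneg: "0 \<le> x u"
    and eig: "u \<in> V \<Longrightarrow> (\<Sum>v\<in>V. of_bool (adj u v) * x v) = l * x u"
    and norm: "(\<Sum>u\<in>V. (x u)\<^sup>2) = 2 * n"
    and size: "(\<Sum>u\<in>V. \<Sum>v\<in>V. of_bool (adj u v)) = 2 * n\<^sup>2"
    and n_pos: "0 < n" and n_le: "n \<le> l"
    and codegree: "u \<in> V \<Longrightarrow> v \<in> V \<Longrightarrow> adj u v \<Longrightarrow> 4 * (\<Sum>w\<in>V. of_bool (adj u w) * of_bool (adj v w)) \<le> n"
begin

abbreviation a :: "'a \<Rightarrow> 'a \<Rightarrow> real" where "a u v \<equiv> of_bool (adj u v)"

lemma a_sym: "a u v = a v u" using adj_sym by (auto simp: of_bool_def)

definition nbr_weight where "nbr_weight u = (\<Sum>w\<in>V. a u w * (x w)\<^sup>2)"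
definition common_weight where "common_weight u v = (\<Sum>w\<in>V. a u w * a v w * (x w)\<^sup>2)"
definition missed_weight where "missed_weight u v = (\<Sum>w\<in>V. (1 - a u w) * (1 - a v w) * (x w)\<^sup>2)"

lemma common_weight_nonneg: "0 \<le> common_weight u v" unfolding common_weight_def by (intro sum_nonneg) auto
lemma missed_weight_nonneg: "0 \<le> missed_weight u v" unfolding missed_weight_def by (intro sum_nonneg) auto
lemma nbr_weight_nonneg: "0 \<le> nbr_weight u" unfolding nbr_weight_def by (intro sum_nonneg) auto
lemma common_weight_le: "common_weight u v \<le> nbr_weight u" unfolding common_weight_def nbr_weight_def by (intro sum_mono) (auto simp: of_bool_def)

lemma missed_minus_common: "missed_weight u v - common_weight u v = 2 * n - nbr_weight u - nbr_weight v"
  unfolding missed_weight_def common_weight_def nbr_weight_def norm[symmetric]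
  by (simp add: sum_subtractf[symmetric] algebra_simps)

lemma quadratic_form: "(\<Sum>u\<in>V. \<Sum>v\<in>V. a u v * (x u * x v)) = 2 * n * l"
proof -
  have "(\<Sum>u\<in>V. \<Sum>v\<in>V. a u v * (x u * x v)) = (\<Sum>u\<in>V. x u * (\<Sum>v\<in>V. a u v * x v))"
    by (simp add: sum_distrib_left algebra_simps)
  also have "\<dots> = (\<Sum>u\<in>V. l * (x u)\<^sup>2)"
    by (intro sum.cong) (simp_all add: eig power2_eq_square)
  finally show ?thesis by (simp add: norm sum_distrib_left[symmetric])
qed

text \<open>Expand \<open>2 n (\<eta> - 1)\<^sup>2\<close> and insert \<open>S - C = 2 n - W u - W v\<close>, where \<open>W\<close> is the neighbourhood weight.
  Only the sum of \<open>\<eta>\<^sup>2\<close>, called \<open>X\<close>, and that of \<open>(x u)\<^sup>2 (W u)\<^sup>2\<close>, called \<open>Y\<close>, are unknown; \<open>Y\<close> is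
  bounded below in terms of \<open>X\<close> because the variance of \<open>W\<close> around \<open>n\<close> is non-negative.\<close>
lemma weighted_count:
  "(\<Sum>u\<in>V. \<Sum>v\<in>V. a u v * (2 * n * (x u * x v - 1)\<^sup>2 + (x u * x v)\<^sup>2 * (missed_weight u v - common_weight u v)))
    \<le> 8 * n\<^sup>2 * (n - l)"
proof -
  define X where "X = (\<Sum>u\<in>V. (x u)\<^sup>2 * nbr_weight u)"
  define Y where "Y = (\<Sum>u\<in>V. (x u)\<^sup>2 * (nbr_weight u)\<^sup>2)"
  have e1: "(\<Sum>u\<in>V. \<Sum>v\<in>V. a u v * (x u * x v)\<^sup>2) = X"
    by (simp add: X_def nbr_weight_def sum_distrib_left power_mult_distrib algebra_simps)
  have e2: "(\<Sum>u\<in>V. \<Sum>v\<in>V. a u v * (x u * x v)\<^sup>2 * nbr_weight u) = Y"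
    by (simp add: Y_def nbr_weight_def[of "_"] power2_eq_square sum_distrib_left sum_distrib_right algebra_simps)
  have e3: "(\<Sum>u\<in>V. \<Sum>v\<in>V. a u v * (x u * x v)\<^sup>2 * nbr_weight v) = Y"
    unfolding e2[symmetric] by (subst sum.swap) (simp add: a_sym mult.commute)
  have "0 \<le> (\<Sum>u\<in>V. (x u)\<^sup>2 * (nbr_weight u - n)\<^sup>2)" by (intro sum_nonneg) auto
  also have "\<dots> = Y - 2 * n * X + n\<^sup>2 * (\<Sum>u\<in>V. (x u)\<^sup>2)"
    unfolding X_def Y_def
    by (simp add: sum_distrib_left sum.distrib sum_subtractf power2_diff algebra_simps)
  also note norm
  finally have Y: "Y \<ge> 2 * n * X - 2 * n ^ 3" by (simp add: power2_eq_square power3_eq_cube)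
  have "(\<Sum>u\<in>V. \<Sum>v\<in>V. a u v * (2 * n * (x u * x v - 1)\<^sup>2 + (x u * x v)\<^sup>2 * (missed_weight u v - common_weight u v)))
    = 4 * n * (\<Sum>u\<in>V. \<Sum>v\<in>V. a u v * (x u * x v)\<^sup>2) - 4 * n * (\<Sum>u\<in>V. \<Sum>v\<in>V. a u v * (x u * x v))
      + 2 * n * (\<Sum>u\<in>V. \<Sum>v\<in>V. a u v) - (\<Sum>u\<in>V. \<Sum>v\<in>V. a u v * (x u * x v)\<^sup>2 * nbr_weight u)
      - (\<Sum>u\<in>V. \<Sum>v\<in>V. a u v * (x u * x v)\<^sup>2 * nbr_weight v)"
    unfolding missed_minus_common
    by (simp add: sum_distrib_left sum.distrib[symmetric] sum_subtractf[symmetric] power2_diff algebra_simps)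
  also have "\<dots> = 4 * n * X - 8 * n\<^sup>2 * l + 4 * n ^ 3 - 2 * Y"
    unfolding quadratic_form e1 e2 e3 size by (simp add: power2_eq_square power3_eq_cube)
  also have "\<dots> \<le> 8 * n ^ 3 - 8 * n\<^sup>2 * l" using Y by simp
  also have "\<dots> = 8 * n\<^sup>2 * (n - l)" by (simp add: power2_eq_square power3_eq_cube algebra_simps)
  finally show ?thesis .
qed

text \<open>By the eigenvalue equation, \<open>l\<close> times the weight of the neighbourhood \<open>N\<close> of \<open>u\<close> is the sum of
  \<open>x v * x w\<close> over the ordered edges \<open>v w\<close> that start in \<open>N\<close>. Twice this exceeds the sum over all edges by at most
  the sum \<open>NN\<close> over the edges inside \<open>N\<close>. An inner degree in \<open>N\<close> is a number
  of common neighbours of an edge at \<open>u\<close>, so \<open>NN\<close> is at most \<open>n / 4\<close> times the weight.\<close>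
lemma nbr_weight_le:
  assumes u: "u \<in> V"
  shows "7 * nbr_weight u \<le> 8 * n"
proof -
  define NN where "NN = (\<Sum>v\<in>V. \<Sum>w\<in>V. a u v * a u w * (a v w * (x v * x w)))"
  have W1: "l * nbr_weight u = (\<Sum>v\<in>V. \<Sum>w\<in>V. a u v * (a v w * (x v * x w)))"
  proof -
    have "l * nbr_weight u = (\<Sum>v\<in>V. a u v * x v * (l * x v))"
      by (simp add: nbr_weight_def sum_distrib_left power2_eq_square algebra_simps)
    also have "\<dots> = (\<Sum>v\<in>V. a u v * x v * (\<Sum>w\<in>V. a v w * x w))" by (simp add: eig)
    finally show ?thesis by (simp add: sum_distrib_left algebra_simps)
  qed
  have W2: "l * nbr_weight u = (\<Sum>v\<in>V. \<Sum>w\<in>V. a u w * (a v w * (x v * x w)))"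
    unfolding W1 by (subst sum.swap) (simp add: a_sym mult.commute)
  have "L = s \<Longrightarrow> L = t \<Longrightarrow> 2 * L - NN = s + t - NN" for L s t :: real by simp
  from this[OF W1 W2] have "2 * (l * nbr_weight u) - NN
    = (\<Sum>v\<in>V. \<Sum>w\<in>V. (a u v + a u w - a u v * a u w) * (a v w * (x v * x w)))"
    unfolding NN_def by (simp only: sum.distrib sum_subtractf left_diff_distrib distrib_right)
  also have "\<dots> \<le> (\<Sum>v\<in>V. \<Sum>w\<in>V. a v w * (x v * x w))"
    using nonneg by (intro sum_mono) (auto simp: of_bool_def)
  finally have 1: "2 * (l * nbr_weight u) - NN \<le> 2 * n * l" by (simp add: quadratic_form)
  have "2 * NN \<le> (\<Sum>v\<in>V. \<Sum>w\<in>V. a u v * a u w * (a v w * ((x v)\<^sup>2 + (x w)\<^sup>2)))"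
    unfolding NN_def sum_distrib_left
  proof (intro sum_mono)
    fix v w
    have "0 \<le> (x v - x w)\<^sup>2" by simp
    then have "2 * (x v * x w) \<le> (x v)\<^sup>2 + (x w)\<^sup>2" by (simp add: power2_diff)
    then have "a u v * a u w * a v w * (2 * (x v * x w)) \<le> a u v * a u w * a v w * ((x v)\<^sup>2 + (x w)\<^sup>2)"
      by (rule mult_left_mono) simp
    then show "2 * (a u v * a u w * (a v w * (x v * x w))) \<le> a u v * a u w * (a v w * ((x v)\<^sup>2 + (x w)\<^sup>2))"
      by (simp only: ac_simps)
  qed
  also have "\<dots> = (\<Sum>v\<in>V. \<Sum>w\<in>V. a u v * a u w * a v w * (x v)\<^sup>2) + (\<Sum>v\<in>V. \<Sum>w\<in>V. a u v * a u w * a v w * (x w)\<^sup>2)"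
    by (simp only: distrib_left mult.assoc sum.distrib)
  also have "(\<Sum>v\<in>V. \<Sum>w\<in>V. a u v * a u w * a v w * (x w)\<^sup>2) = (\<Sum>v\<in>V. \<Sum>w\<in>V. a u v * a u w * a v w * (x v)\<^sup>2)"
    by (subst sum.swap) (simp add: a_sym ac_simps)
  also have "(\<Sum>v\<in>V. \<Sum>w\<in>V. a u v * a u w * a v w * (x v)\<^sup>2)
      = (\<Sum>v\<in>V. (a u v * (x v)\<^sup>2) * (\<Sum>w\<in>V. a u w * a v w))"
    by (simp add: sum_distrib_left algebra_simps)
  finally have "NN \<le> (\<Sum>v\<in>V. (a u v * (x v)\<^sup>2) * (\<Sum>w\<in>V. a u w * a v w))" by simp
  also have "\<dots> \<le> (\<Sum>v\<in>V. (a u v * (x v)\<^sup>2) * (n / 4))"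
  proof (intro sum_mono)
    fix v assume v: "v \<in> V"
    show "(a u v * (x v)\<^sup>2) * (\<Sum>w\<in>V. a u w * a v w) \<le> (a u v * (x v)\<^sup>2) * (n / 4)"
    proof (cases "adj u v")
      case True
      then show ?thesis using codegree[OF u v] by (intro mult_left_mono) auto
    qed simp
  qed
  also have "\<dots> = n / 4 * nbr_weight u" by (simp add: nbr_weight_def sum_distrib_left ac_simps)
  finally have 2: "NN \<le> n / 4 * nbr_weight u" .
  have "2 * (l * nbr_weight u) - n / 4 * nbr_weight u \<le> 2 * n * l" using 1 2 by linarith
  moreover have "n * nbr_weight u \<le> l * nbr_weight u" using n_le nbr_weight_nonneg by (rule mult_right_mono)
  ultimately have "l * (7 * nbr_weight u) \<le> l * (8 * n)" by (simp add: mult_ac)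
  then show ?thesis using n_pos n_le by simp
qed

text \<open>The factor \<open>\<kappa> = K / (2 n)\<close> is the total rate at which the edge hands its \<open>S + C\<close> to its triangles. Since
  no more than \<open>n / 4\<close> triangles, each with bonus at most \<open>\<eta>\<^sup>2\<close>, contain the edge, \<open>\<kappa> \<le> \<eta>\<^sup>2\<close>. What is
  left over must be covered by the charges.\<close>
lemma edge_excess_ge:
  assumes uv: "u \<in> V" "v \<in> V" "adj u v"
  defines "K \<equiv> 8 * (\<Sum>w\<in>V. a u w * a v w * bonus (x u) (x v) (x w))"
  shows "2 * n * (x u * x v - 1)\<^sup>2 + (x u * x v)\<^sup>2 * (missed_weight u v - common_weight u v)
    \<ge> K / (2 * n) * (missed_weight u v + common_weight u v)
      + (\<Sum>w\<in>V. a u w * a v w * charge (bonus (x u) (x v) (x w)) (x w) (x u * x v))"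
proof -
  define \<eta> where "\<eta> = x u * x v"
  define f where "f w = bonus (x u) (x v) (x w)" for w
  define c where "c w = a u w * a v w" for w
  define \<kappa> where "\<kappa> = K / (2 * n)"
  define k where "k = (\<Sum>w\<in>V. c w)"
  have c0: "0 \<le> c w" for w by (simp add: c_def)
  have k: "8 * k \<le> 2 * n" using codegree[OF uv] by (simp add: k_def c_def)
  have k0: "0 \<le> k" unfolding k_def by (intro sum_nonneg c0)
  have f: "f w \<le> \<eta>\<^sup>2" "0 \<le> f w" for w
    unfolding f_def \<eta>_def using nonneg by (auto simp: bonus_le bonus_nonneg)
  have K: "K = 8 * (\<Sum>w\<in>V. c w * f w)" by (simp add: K_def c_def f_def)
  have \<kappa>0: "0 \<le> \<kappa>" unfolding \<kappa>_def K using n_pos f c0 by (auto intro!: divide_nonneg_pos sum_nonneg)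
  have "(\<Sum>w\<in>V. c w * f w) \<le> (\<Sum>w\<in>V. c w * \<eta>\<^sup>2)" using f c0 by (intro sum_mono mult_left_mono) auto
  then have "K \<le> 8 * k * \<eta>\<^sup>2" by (simp add: K k_def sum_distrib_right)
  also have "\<dots> \<le> 2 * n * \<eta>\<^sup>2" using k by (intro mult_right_mono) auto
  finally have \<kappa>: "\<kappa> \<le> \<eta>\<^sup>2" using n_pos by (simp add: \<kappa>_def divide_le_eq ac_simps)
  have scale: "(\<Sum>w\<in>V. c w * (8 * y)) \<le> 2 * n * y" if "0 \<le> y" for y
    using mult_right_mono[OF k that] by (simp add: k_def sum_distrib_right[symmetric])
  show ?thesis
  proof (cases "\<eta> < 7/2")
    case True
    \<comment> \<open>The bonus grows with the third vertex, so Chebyshev bounds the product of the averages of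
      bonus and weight by the average of their product.\<close>
    have cheb: "\<kappa> * common_weight u v \<le> (\<Sum>w\<in>V. c w * (f w * (x w)\<^sup>2))"
    proof -
      have "(\<Sum>w\<in>V. c w * f w) * (\<Sum>w\<in>V. c w * (x w)\<^sup>2) \<le> k * (\<Sum>w\<in>V. c w * (f w * (x w)\<^sup>2))"
        unfolding k_def
      proof (rule chebyshev_sum)
        fix i j
        show "0 \<le> (f i - f j) * ((x i)\<^sup>2 - (x j)\<^sup>2)"
        proof (cases "x i \<le> x j")
          case True
          then have "f i \<le> f j" "(x i)\<^sup>2 \<le> (x j)\<^sup>2"
            unfolding f_def using nonneg by (auto intro: bonus_mono power_mono)
          then show ?thesis by (intro mult_nonpos_nonpos) auto
        next
          case False
          then have "f j \<le> f i" "(x j)\<^sup>2 \<le> (x i)\<^sup>2"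
            unfolding f_def using nonneg by (auto intro: bonus_mono power_mono)
          then show ?thesis by (intro mult_nonneg_nonneg) auto
        qed
      qed (rule c0)
      then have "8 * ((\<Sum>w\<in>V. c w * f w) * (\<Sum>w\<in>V. c w * (x w)\<^sup>2)) \<le> 8 * k * (\<Sum>w\<in>V. c w * (f w * (x w)\<^sup>2))"
        by simp
      also have "\<dots> \<le> 2 * n * (\<Sum>w\<in>V. c w * (f w * (x w)\<^sup>2))"
        using k c0 f by (intro mult_right_mono sum_nonneg mult_nonneg_nonneg) auto
      finally have "K * common_weight u v \<le> 2 * n * (\<Sum>w\<in>V. c w * (f w * (x w)\<^sup>2))" by (simp add: K common_weight_def c_def)
      then show ?thesis using n_pos by (simp add: \<kappa>_def divide_le_eq ac_simps)
    qed
    have "(\<Sum>w\<in>V. c w * charge (f w) (x w) \<eta>)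
      = (\<Sum>w\<in>V. c w * (8 * (\<eta> - 1)\<^sup>2)) - \<eta>\<^sup>2 * (\<Sum>w\<in>V. c w * (x w)\<^sup>2) - (\<Sum>w\<in>V. c w * (f w * (x w)\<^sup>2))"
      using True by (simp add: charge_def sum_distrib_left sum_subtractf[symmetric] algebra_simps)
    also have "\<dots> \<le> 2 * n * (\<eta> - 1)\<^sup>2 - \<eta>\<^sup>2 * common_weight u v - \<kappa> * common_weight u v"
      using scale[of "(\<eta> - 1)\<^sup>2"] cheb by (simp add: common_weight_def c_def)
    finally have "(\<Sum>w\<in>V. c w * charge (f w) (x w) \<eta>) \<le> 2 * n * (\<eta> - 1)\<^sup>2 - \<eta>\<^sup>2 * common_weight u v - \<kappa> * common_weight u v" .
    moreover have "\<kappa> * missed_weight u v \<le> \<eta>\<^sup>2 * missed_weight u v" using \<kappa> missed_weight_nonneg by (rule mult_right_mono)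
    ultimately have "\<kappa> * (missed_weight u v + common_weight u v) + (\<Sum>w\<in>V. c w * charge (f w) (x w) \<eta>)
      \<le> 2 * n * (\<eta> - 1)\<^sup>2 + \<eta>\<^sup>2 * (missed_weight u v - common_weight u v)"
      by (simp add: algebra_simps)
    then show ?thesis by (simp add: \<kappa>_def \<eta>_def c_def f_def)
  next
    case False
    have "0 \<le> (\<eta> - 7/2) * (6/7 * (\<eta> - 7/2) + 4) + 1/2" using False by simp
    also have "\<dots> = (\<eta> - 1)\<^sup>2 - \<eta>\<^sup>2 / 7 - 4" by (simp add: power2_eq_square field_simps)
    finally have heavy: "0 \<le> (\<eta> - 1)\<^sup>2 - \<eta>\<^sup>2 / 7" by simp
    \<comment> \<open>Use \<open>\<eta>\<^sup>2 (S - C) = \<kappa> (S + C) - 2 \<kappa> C + (\<eta>\<^sup>2 - \<kappa>) (S - C)\<close> and bound \<open>C\<close> and \<open>S - C\<close> a priori.\<close>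
    have sc: "missed_weight u v - common_weight u v \<ge> - 2 * n / 7" using missed_minus_common[of u v] nbr_weight_le[OF uv(1)] nbr_weight_le[OF uv(2)] by simp
    have c7: "7 * common_weight u v \<le> 8 * n" using common_weight_le[of u v] nbr_weight_le[OF uv(1)] by simp
    have "(\<Sum>w\<in>V. c w * charge (f w) (x w) \<eta>)
      = (\<Sum>w\<in>V. c w * (8 * ((\<eta> - 1)\<^sup>2 - \<eta>\<^sup>2 / 7))) - 8 * (\<Sum>w\<in>V. c w * f w)"
      using False by (simp add: charge_def sum_distrib_left sum_subtractf[symmetric] algebra_simps)
    also have "\<dots> \<le> 2 * n * ((\<eta> - 1)\<^sup>2 - \<eta>\<^sup>2 / 7) - \<kappa> * (2 * n)"
      using scale[OF heavy] n_pos by (simp add: \<kappa>_def K)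
    finally have 1: "(\<Sum>w\<in>V. c w * charge (f w) (x w) \<eta>) \<le> 2 * n * ((\<eta> - 1)\<^sup>2 - \<eta>\<^sup>2 / 7) - \<kappa> * (2 * n)" .
    have 2: "(\<eta>\<^sup>2 - \<kappa>) * (- 2 * n) \<le> (\<eta>\<^sup>2 - \<kappa>) * (7 * (missed_weight u v - common_weight u v))"
      using \<kappa> sc by (intro mult_left_mono) auto
    have 3: "\<kappa> * (7 * common_weight u v) \<le> \<kappa> * (8 * n)" using c7 \<kappa>0 by (rule mult_left_mono)
    have "\<kappa> * (missed_weight u v + common_weight u v) + (\<Sum>w\<in>V. c w * charge (f w) (x w) \<eta>)
      \<le> 2 * n * (\<eta> - 1)\<^sup>2 + \<eta>\<^sup>2 * (missed_weight u v - common_weight u v)"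
      using 1 2 3 by (simp add: field_simps)
    then show ?thesis by (simp add: \<kappa>_def \<eta>_def c_def f_def)
  qed
qed

text \<open>Sums over ordered triples are symmetrised by rotating the triple, which distributes each charge
  evenly over the three edges of a triangle.\<close>
lemma rotate_sum:
  "(\<Sum>u\<in>V. \<Sum>v\<in>V. \<Sum>w\<in>V. g u v w) = (\<Sum>u\<in>V. \<Sum>v\<in>V. \<Sum>w\<in>V. g v w u)"
  for g :: "'a \<Rightarrow> 'a \<Rightarrow> 'a \<Rightarrow> real"
proof -
  have "(\<Sum>u\<in>V. \<Sum>v\<in>V. \<Sum>w\<in>V. g v w u) = (\<Sum>v\<in>V. \<Sum>u\<in>V. \<Sum>w\<in>V. g v w u)" by (rule sum.swap)
  also have "\<dots> = (\<Sum>v\<in>V. \<Sum>w\<in>V. \<Sum>u\<in>V. g v w u)" by (intro sum.cong refl sum.swap)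
  finally show ?thesis by simp
qed

definition tri where "tri u v w = a u v * a u w * a v w"
definition triangle_bonus where "triangle_bonus u v w = bonus (x u) (x v) (x w)"
definition edge_charge where "edge_charge u v w = charge (triangle_bonus u v w) (x w) (x u * x v)"

lemma tri_rotate: "tri v w u = tri u v w"
  by (simp add: tri_def a_sym ac_simps)

lemma triangle_bonus_rotate: "triangle_bonus v w u = triangle_bonus u v w"
  by (metis triangle_bonus_def bonus_commute)

lemma triangle_pos: "0 < 8 * triangle_bonus u v w + edge_charge u v w + edge_charge v w u + edge_charge w u v"
  using triangle_charge_pos[of "x u" "x v" "x w"] nonneg
  by (simp add: edge_charge_def triangle_bonus_rotate) (simp add: triangle_bonus_def mult.commute algebra_simps)

lemma missed_plus_common: "missed_weight u v + common_weight u v = (\<Sum>z\<in>V. ((1 - a u z) * (1 - a v z) + a u z * a v z) * (x z)\<^sup>2)"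
  by (simp only: missed_weight_def common_weight_def distrib_right sum.distrib)

text \<open>Among the three adjacencies of \<open>z\<close> to \<open>u\<close>, \<open>v\<close> and \<open>w\<close> two agree, so \<open>z\<close> counts for at least one
  of the three pairs.\<close>
lemma triangle_cover: "2 * n \<le> (missed_weight u v + common_weight u v) + (missed_weight v w + common_weight v w) + (missed_weight w u + common_weight w u)"
proof -
  have "2 * n = (\<Sum>z\<in>V. 1 * (x z)\<^sup>2)" by (simp add: norm)
  also have "\<dots> \<le> (\<Sum>z\<in>V. (((1 - a u z) * (1 - a v z) + a u z * a v z)
      + ((1 - a v z) * (1 - a w z) + a v z * a w z) + ((1 - a w z) * (1 - a u z) + a w z * a u z)) * (x z)\<^sup>2)"
    by (intro sum_mono mult_right_mono) auto
  also have "\<dots> = (missed_weight u v + common_weight u v) + (missed_weight v w + common_weight v w) + (missed_weight w u + common_weight w u)"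
    unfolding missed_plus_common by (simp only: sum.distrib[symmetric] distrib_right)
  finally show ?thesis .
qed

text \<open>Sum \<open>edge_excess_ge\<close> over all ordered edges and add the three rotations. The terms with
  \<open>S + C\<close> become the bonus times the sum over the three edges that \<open>triangle_cover\<close> bounds below.\<close>
lemma triangle_sum:
  "(\<Sum>u\<in>V. \<Sum>v\<in>V. \<Sum>w\<in>V. tri u v w * (8 * triangle_bonus u v w + edge_charge u v w + edge_charge v w u + edge_charge w u v))
    \<le> 24 * n\<^sup>2 * (n - l)"
proof -
  define g where "g u v w = tri u v w * (4 / n * triangle_bonus u v w * (missed_weight u v + common_weight u v) + edge_charge u v w)" for u v w
  have "(\<Sum>w\<in>V. g u v w) \<le> a u v * (2 * n * (x u * x v - 1)\<^sup>2 + (x u * x v)\<^sup>2 * (missed_weight u v - common_weight u v))"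
    if "u \<in> V" "v \<in> V" for u v
  proof (cases "adj u v")
    case True
    have "(\<Sum>w\<in>V. g u v w) = 8 * (\<Sum>w\<in>V. a u w * a v w * bonus (x u) (x v) (x w)) / (2 * n) * (missed_weight u v + common_weight u v)
      + (\<Sum>w\<in>V. a u w * a v w * charge (bonus (x u) (x v) (x w)) (x w) (x u * x v))"
      using True n_pos
      by (simp add: g_def tri_def triangle_bonus_def edge_charge_def sum_distrib_left sum_distrib_right sum.distrib
          sum_divide_distrib distrib_left mult_ac)
    also have "\<dots> \<le> 2 * n * (x u * x v - 1)\<^sup>2 + (x u * x v)\<^sup>2 * (missed_weight u v - common_weight u v)"
      by (rule edge_excess_ge[OF that True])
    finally show ?thesis using True by simp
  qed (simp add: g_def tri_def)
  then have "(\<Sum>u\<in>V. \<Sum>v\<in>V. \<Sum>w\<in>V. g u v w) \<le> 8 * n\<^sup>2 * (n - l)"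
    by (intro order_trans[OF _ weighted_count] sum_mono) auto
  moreover have "(\<Sum>u\<in>V. \<Sum>v\<in>V. \<Sum>w\<in>V. g u v w) = (\<Sum>u\<in>V. \<Sum>v\<in>V. \<Sum>w\<in>V. g v w u)"
    by (rule rotate_sum)
  moreover have "(\<Sum>u\<in>V. \<Sum>v\<in>V. \<Sum>w\<in>V. g v w u) = (\<Sum>u\<in>V. \<Sum>v\<in>V. \<Sum>w\<in>V. g w u v)"
    by (rule rotate_sum)
  ultimately have le: "(\<Sum>u\<in>V. \<Sum>v\<in>V. \<Sum>w\<in>V. g u v w + g v w u + g w u v) \<le> 24 * n\<^sup>2 * (n - l)"
    unfolding sum.distrib by linarith
  have "tri u v w * (8 * triangle_bonus u v w + edge_charge u v w + edge_charge v w u + edge_charge w u v) \<le> g u v w + g v w u + g w u v" for u v w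
  proof -
    have "0 \<le> tri u v w * (4 / n * triangle_bonus u v w)"
      using n_pos by (auto simp: tri_def triangle_bonus_def bonus_nonneg)
    from mult_left_mono[OF triangle_cover this, of u v w]
    have "tri u v w * (8 * triangle_bonus u v w) \<le> tri u v w * (4 / n * triangle_bonus u v w)
        * ((missed_weight u v + common_weight u v) + (missed_weight v w + common_weight v w) + (missed_weight w u + common_weight w u))"
      using n_pos by (simp add: mult_ac)
    moreover have "g u v w + g v w u + g w u v = tri u v w * (4 / n * triangle_bonus u v w)
        * ((missed_weight u v + common_weight u v) + (missed_weight v w + common_weight v w) + (missed_weight w u + common_weight w u)) + tri u v w * (edge_charge u v w + edge_charge v w u + edge_charge w u v)"
      unfolding g_def tri_rotate[of v w u] tri_rotate[of w u v, symmetric] tri_rotate[of u v w]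
        triangle_bonus_rotate[of v w u] triangle_bonus_rotate[of u v w] triangle_bonus_rotate[of w u v, symmetric]
      by (simp add: algebra_simps add_divide_distrib)
    ultimately show ?thesis by (simp add: algebra_simps)
  qed
  then have "(\<Sum>u\<in>V. \<Sum>v\<in>V. \<Sum>w\<in>V. tri u v w * (8 * triangle_bonus u v w + edge_charge u v w + edge_charge v w u + edge_charge w u v))
    \<le> (\<Sum>u\<in>V. \<Sum>v\<in>V. \<Sum>w\<in>V. g u v w + g v w u + g w u v)"
    by (intro sum_mono)
  with le show ?thesis by linarith
qed

lemma tri_term_nonneg: "0 \<le> tri u v w * (8 * triangle_bonus u v w + edge_charge u v w + edge_charge v w u + edge_charge w u v)"
  using triangle_pos[of u v w] by (simp add: tri_def)

lemma eigenvalue_eq: "l = n"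
proof -
  have "0 \<le> 24 * n\<^sup>2 * (n - l)"
    by (rule order_trans[OF _ triangle_sum]) (intro sum_nonneg tri_term_nonneg)
  then show ?thesis using n_pos n_le by (simp add: zero_le_mult_iff)
qed

lemma triangle_free:
  assumes "u \<in> V" "v \<in> V" "w \<in> V" "adj u v" "adj u w" "adj v w"
  shows False
proof -
  have "tri u v w * (8 * triangle_bonus u v w + edge_charge u v w + edge_charge v w u + edge_charge w u v)
    \<le> (\<Sum>w\<in>V. tri u v w * (8 * triangle_bonus u v w + edge_charge u v w + edge_charge v w u + edge_charge w u v))"
    using assms(3) fin by (intro member_le_sum tri_term_nonneg)
  also have "\<dots> \<le> (\<Sum>v\<in>V. \<Sum>w\<in>V. tri u v w * (8 * triangle_bonus u v w + edge_charge u v w + edge_charge v w u + edge_charge w u v))"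
    by (rule member_le_sum) (use assms fin in \<open>auto intro: sum_nonneg tri_term_nonneg\<close>)
  also have "\<dots> \<le> (\<Sum>u\<in>V. \<Sum>v\<in>V. \<Sum>w\<in>V. tri u v w * (8 * triangle_bonus u v w + edge_charge u v w + edge_charge v w u + edge_charge w u v))"
    by (rule member_le_sum) (use assms fin in \<open>auto intro: sum_nonneg tri_term_nonneg\<close>)
  also have "\<dots> \<le> 0" using triangle_sum by (simp add: eigenvalue_eq)
  finally show False using triangle_pos[of u v w] assms by (simp add: tri_def)
qed

lemma edge_extremal:
  assumes "u \<in> V" "v \<in> V" "adj u v"
  shows "x u * x v = 1" "missed_weight u v = 0"
proof -
  define h where "h u v = a u v * (2 * n * (x u * x v - 1)\<^sup>2 + (x u * x v)\<^sup>2 * (missed_weight u v - common_weight u v))" for u v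
  have C0: "a u v * common_weight u v = 0" if "u \<in> V" "v \<in> V" for u v
  proof (cases "adj u v")
    case True
    then have "a u w * a v w = 0" if "w \<in> V" for w
      using triangle_free[OF \<open>u \<in> V\<close> \<open>v \<in> V\<close> that] by auto
    then show ?thesis unfolding common_weight_def by (subst sum.neutral) auto
  qed simp
  have h: "h u v = a u v * (2 * n * (x u * x v - 1)\<^sup>2 + (x u * x v)\<^sup>2 * missed_weight u v)" if "u \<in> V" "v \<in> V" for u v
    using C0[OF that] by (simp add: h_def)
  have h0: "0 \<le> h u v" if "u \<in> V" "v \<in> V" for u v
    unfolding h[OF that] using n_pos missed_weight_nonneg by auto
  have "h u v \<le> (\<Sum>v\<in>V. h u v)"
    by (rule member_le_sum) (use assms fin h0 in auto)
  also have "\<dots> \<le> (\<Sum>u\<in>V. \<Sum>v\<in>V. h u v)"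
    by (rule member_le_sum) (use assms fin h0 in \<open>auto intro: sum_nonneg\<close>)
  also have "\<dots> \<le> 0" using weighted_count by (simp add: eigenvalue_eq h_def)
  finally have "2 * n * (x u * x v - 1)\<^sup>2 + (x u * x v)\<^sup>2 * missed_weight u v \<le> 0"
    using assms by (simp add: h)
  moreover have "0 \<le> 2 * n * (x u * x v - 1)\<^sup>2" "0 \<le> (x u * x v)\<^sup>2 * missed_weight u v"
    using n_pos missed_weight_nonneg by auto
  ultimately have "2 * n * (x u * x v - 1)\<^sup>2 = 0" "(x u * x v)\<^sup>2 * missed_weight u v = 0" by linarith+
  then show "x u * x v = 1" "missed_weight u v = 0" using n_pos by auto
qed

lemma edge_reaches_support:
  assumes "u \<in> V" "v \<in> V" "adj u v" "z \<in> V" "x z \<noteq> 0"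
  shows "adj u z \<or> adj v z"
proof (rule ccontr)
  assume "\<not> ?thesis"
  have "(1 - a u z) * (1 - a v z) * (x z)\<^sup>2 \<le> missed_weight u v"
    unfolding missed_weight_def using assms(4) fin by (intro member_le_sum) auto
  with \<open>\<not> ?thesis\<close> show False using edge_extremal(2)[OF assms(1-3)] assms(5) by simp
qed

end

section \<open>Existence of the principal eigenvector\<close>

text \<open>First-order condition at a maximum: a linear term cannot be dominated by a quadratic one near \<open>0\<close>.\<close>
lemma linear_term_zero:
  fixes b c :: real
  assumes "\<And>t. t * b \<le> t\<^sup>2 * c"
  shows "b = 0"
proof (rule ccontr)
  assume b: "b \<noteq> 0"
  define k where "k = \<bar>c\<bar> + 1"
  have k: "0 < k" "c < k" by (auto simp: k_def)
  have "b / k * b \<le> (b / k)\<^sup>2 * c" by (rule assms)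
  then have "b\<^sup>2 * k \<le> b\<^sup>2 * c" using k by (simp add: field_simps power2_eq_square)
  then show False using b k by (simp add: mult_le_cancel_left)
qed

text \<open>Fixing the values outside \<open>V\<close> makes the sphere a closed subset of a product of compact sets.\<close>
lemma compact_unit_sphere:
  assumes "finite V"
  shows "compact {x :: 'a \<Rightarrow> real. (\<forall>u. u \<notin> V \<longrightarrow> x u = 0) \<and> (\<Sum>u\<in>V. (x u)\<^sup>2) = 1}"
proof -
  define B where "B = (\<Pi>\<^sub>E u\<in>(UNIV :: 'a set). if u \<in> V then {-1..1::real} else {0})"
  have "compactin (product_topology (\<lambda>_. euclidean) UNIV) B"
    unfolding B_def by (subst compactin_PiE) auto
  then have "compact B" by (simp add: euclidean_product_topology)
  moreover have "closed {x :: 'a \<Rightarrow> real. (\<Sum>u\<in>V. (x u)\<^sup>2) = 1}"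
    by (intro closed_Collect_eq continuous_intros) auto
  ultimately have "compact (B \<inter> {x. (\<Sum>u\<in>V. (x u)\<^sup>2) = 1})" by (rule compact_Int_closed)
  also have "B \<inter> {x. (\<Sum>u\<in>V. (x u)\<^sup>2) = 1} = {x. (\<forall>u. u \<notin> V \<longrightarrow> x u = 0) \<and> (\<Sum>u\<in>V. (x u)\<^sup>2) = 1}"
  proof -
    have "\<bar>x u\<bar> \<le> 1" if "u \<in> V" "(\<Sum>u\<in>V. (x u)\<^sup>2) = 1" for x :: "'a \<Rightarrow> real" and u
    proof -
      have "(x u)\<^sup>2 \<le> (\<Sum>u\<in>V. (x u)\<^sup>2)" using that assms by (intro member_le_sum) auto
      then show ?thesis using that(2) abs_square_le_1 by metis
    qed
    then show ?thesis by (fastforce simp: B_def PiE_iff abs_le_iff split: if_splits)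
  qed
  finally show ?thesis .
qed

text \<open>Maximise the quadratic form \<open>Q\<close> over the unit sphere. Non-negative entries make it possible to replace a maximiser by its
  absolute value \<open>x\<close>. Moving \<open>x\<close> in the direction of the residual \<open>r\<close> of the eigenvalue equation
  changes \<open>Q - l N\<close> to first order by twice the squared norm of \<open>r\<close>, so \<open>r = 0\<close>. Every other
  eigenvalue is a value of the Rayleigh quotient and hence at most \<open>l\<close>.\<close>
lemma perron_vector:
  fixes a :: "'a \<Rightarrow> 'a \<Rightarrow> real"
  assumes fin: "finite V" and ne: "V \<noteq> {}" and a_sym: "\<And>u v. a u v = a v u" and a_pos: "\<And>u v. 0 \<le> a u v"
  obtains l x where "\<And>u. 0 \<le> x u" "(\<Sum>u\<in>V. (x u)\<^sup>2) = 1" "\<And>u. u \<in> V \<Longrightarrow> (\<Sum>v\<in>V. a u v * x v) = l * x u"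
    "\<And>k y. \<exists>u\<in>V. y u \<noteq> 0 \<Longrightarrow> \<forall>u\<in>V. (\<Sum>v\<in>V. a u v * y v) = k * y u \<Longrightarrow> k \<le> l"
proof -
  define Q where "Q x = (\<Sum>u\<in>V. \<Sum>v\<in>V. a u v * (x u * x v))" for x :: "'a \<Rightarrow> real"
  define N where "N x = (\<Sum>u\<in>V. (x u)\<^sup>2)" for x :: "'a \<Rightarrow> real"
  define K where "K = {x :: 'a \<Rightarrow> real. (\<forall>u. u \<notin> V \<longrightarrow> x u = 0) \<and> N x = 1}"
  obtain u0 where u0: "u0 \<in> V" using ne by auto
  have "(\<lambda>u. if u = u0 then 1 else 0) \<in> K"
    using u0 fin by (auto simp: K_def N_def if_distrib[of "\<lambda>x. x\<^sup>2"] cong: if_cong)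
  moreover have "compact K" unfolding K_def N_def by (rule compact_unit_sphere[OF fin])
  moreover have "continuous_on K Q"
    unfolding Q_def by (intro continuous_intros continuous_on_product_coordinates[THEN continuous_on_subset]) auto
  ultimately obtain x0 where x0: "x0 \<in> K" "\<And>y. y \<in> K \<Longrightarrow> Q y \<le> Q x0"
    using continuous_attains_sup[of K Q] by auto
  define x where "x u = \<bar>x0 u\<bar>" for u
  define l where "l = Q x"
  have x: "x \<in> K" using x0(1) by (simp add: K_def N_def x_def)
  have "Q x0 \<le> Q x" unfolding Q_def x_def abs_mult[symmetric]
    by (intro sum_mono mult_left_mono a_pos abs_ge_self)
  then have max: "Q y \<le> l" if "y \<in> K" for y using x0(2)[OF that] by (simp add: l_def)
  have rayleigh: "Q y \<le> l * N y" for y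
  proof (cases "N y = 0")
    case True
    then have "y u = 0" if "u \<in> V" for u
      using that fin by (simp add: N_def sum_nonneg_eq_0_iff)
    then have "Q y = 0" by (simp add: Q_def)
    with True show ?thesis by simp
  next
    case False
    define z where "z u = (if u \<in> V then y u / sqrt (N y) else 0)" for u
    have pos: "0 < N y" using False by (simp add: N_def less_le sum_nonneg)
    have "N z = (\<Sum>u\<in>V. (y u)\<^sup>2 / N y)" unfolding N_def[of z] z_def
      using pos by (intro sum.cong) (auto simp: power_divide)
    also have "\<dots> = 1" using pos by (simp add: N_def sum_divide_distrib[symmetric])
    finally have "z \<in> K" by (simp add: K_def z_def)
    then have "Q z \<le> l" by (rule max)
    moreover have "Q z = (\<Sum>u\<in>V. \<Sum>v\<in>V. a u v * (y u * y v) / N y)" unfolding Q_def z_def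
      using pos by (intro sum.cong) auto
    then have "Q z = Q y / N y" by (simp add: Q_def sum_divide_distrib)
    ultimately show ?thesis using pos by (simp add: divide_le_eq)
  qed
  have eig: "(\<Sum>v\<in>V. a u v * x v) = l * x u" if u: "u \<in> V" for u
  proof -
    define r where "r u = (\<Sum>v\<in>V. a u v * x v) - l * x u" for u
    have "t * (2 * N r) \<le> t\<^sup>2 * (l * N r - Q r)" for t
    proof -
      define P where "P = (\<Sum>u\<in>V. \<Sum>v\<in>V. a u v * (r u * x v))"
      have P': "(\<Sum>u\<in>V. \<Sum>v\<in>V. a u v * (x u * r v)) = P"
        unfolding P_def by (subst sum.swap) (simp add: a_sym mult.commute)
      define M where "M = (\<Sum>u\<in>V. r u * x u)"
      have "P = (\<Sum>u\<in>V. r u * (\<Sum>v\<in>V. a u v * x v))"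
        by (simp add: P_def sum_distrib_left mult_ac)
      also have "\<dots> = (\<Sum>u\<in>V. r u * (r u + l * x u))" by (simp add: r_def)
      also have "\<dots> = N r + l * M"
        by (simp add: N_def M_def sum.distrib sum_distrib_left power2_eq_square algebra_simps)
      finally have P: "P = N r + l * M" .
      have Qt: "Q (\<lambda>u. x u + t * r u) = Q x + t * P + t * (\<Sum>u\<in>V. \<Sum>v\<in>V. a u v * (x u * r v)) + t\<^sup>2 * Q r"
      proof -
        have "a u v * ((x u + t * r u) * (x v + t * r v)) = a u v * (x u * x v) + t * (a u v * (r u * x v))
            + t * (a u v * (x u * r v)) + t\<^sup>2 * (a u v * (r u * r v))" for u v
          by (simp add: power2_eq_square algebra_simps)
        then show ?thesis unfolding Q_def P_def by (simp only: sum.distrib sum_distrib_left)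
      qed
      have Nt: "N (\<lambda>u. x u + t * r u) = N x + 2 * t * M + t\<^sup>2 * N r"
      proof -
        have "(x u + t * r u)\<^sup>2 = (x u)\<^sup>2 + 2 * t * (r u * x u) + t\<^sup>2 * (r u)\<^sup>2" for u
          by (simp add: power2_eq_square algebra_simps)
        then show ?thesis unfolding N_def M_def by (simp only: sum.distrib sum_distrib_left)
      qed
      have Nx: "N x = 1" using x by (simp add: K_def)
      have "Q x + t * P + t * P + t\<^sup>2 * Q r \<le> l * (1 + 2 * t * M + t\<^sup>2 * N r)"
        using rayleigh[of "\<lambda>u. x u + t * r u"] unfolding Qt Nt P' Nx .
      moreover have "l * (1 + 2 * t * M + t\<^sup>2 * N r) - (Q x + t * P + t * P + t\<^sup>2 * Q r)
          = t\<^sup>2 * (l * N r - Q r) - t * (2 * N r)"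
        unfolding P l_def by (simp add: algebra_simps)
      ultimately show ?thesis by linarith
    qed
    then have "2 * N r = 0" by (rule linear_term_zero)
    then have "r u = 0" using u fin by (simp add: N_def sum_nonneg_eq_0_iff)
    then show ?thesis by (simp add: r_def)
  qed
  have "k \<le> l" if y: "\<exists>u\<in>V. y u \<noteq> 0" "\<forall>u\<in>V. (\<Sum>v\<in>V. a u v * y v) = k * y u" for k y
  proof -
    obtain u where u: "u \<in> V" "y u \<noteq> 0" using y by auto
    have "(y u)\<^sup>2 \<le> N y" unfolding N_def using fin u by (intro member_le_sum) auto
    moreover have "0 < (y u)\<^sup>2" using u by simp
    ultimately have pos: "0 < N y" by linarith
    have "Q y = (\<Sum>u\<in>V. y u * (\<Sum>v\<in>V. a u v * y v))"
      by (simp add: Q_def sum_distrib_left mult_ac)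
    also have "\<dots> = (\<Sum>u\<in>V. k * (y u)\<^sup>2)"
      using y(2) by (intro sum.cong) (auto simp: power2_eq_square)
    also have "\<dots> = k * N y" by (simp add: N_def sum_distrib_left)
    finally have "k * N y \<le> l * N y" using rayleigh[of y] by simp
    then show ?thesis using pos by simp
  qed
  with that[of x l] eig x show thesis by (auto simp: K_def N_def x_def)
qed

lemma max_eigenvalue_perron:
  fixes G :: "'a graph"
  defines "a \<equiv> \<lambda>u v. of_bool ({u, v} \<in> edges G) :: real"
  assumes fin: "finite (verts G)" and ne: "verts G \<noteq> {}"
  obtains x where "\<And>u. 0 \<le> x u" "(\<Sum>u\<in>verts G. (x u)\<^sup>2) = 1"
    "\<And>u. u \<in> verts G \<Longrightarrow> (\<Sum>v\<in>verts G. a u v * x v) = max_eigenvalue G * x u"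
    "\<And>k y. \<exists>u\<in>verts G. y u \<noteq> 0 \<Longrightarrow> \<forall>u\<in>verts G. (\<Sum>v\<in>verts G. a u v * y v) = k * y u \<Longrightarrow> k \<le> max_eigenvalue G"
proof -
  obtain l x where x: "\<And>u. 0 \<le> x u" "(\<Sum>u\<in>verts G. (x u)\<^sup>2) = 1"
    "\<And>u. u \<in> verts G \<Longrightarrow> (\<Sum>v\<in>verts G. a u v * x v) = l * x u"
    "\<And>k y. \<exists>u\<in>verts G. y u \<noteq> 0 \<Longrightarrow> \<forall>u\<in>verts G. (\<Sum>v\<in>verts G. a u v * y v) = k * y u \<Longrightarrow> k \<le> l"
    by (rule perron_vector[OF fin ne, of a]) (auto simp: a_def insert_commute)
  define M where "M = adjacency_matrix (vertex_ordering G) G"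
  have ev: "eigenvalue M k \<longleftrightarrow> (\<exists>y. (\<exists>v\<in>verts G. y v \<noteq> 0) \<and> (\<forall>v\<in>verts G. (\<Sum>u\<in>verts G. a v u * y u) = k * y v))" for k
    unfolding M_def eigenvalue_adjacency_matrix_iff[OF vertex_ordering(1)[OF fin]] vertex_ordering(2)[OF fin]
      a_def of_bool_def ..
  have "\<exists>v\<in>verts G. x v \<noteq> 0" using x(2) by (metis sum.neutral zero_neq_one zero_power2)
  then have "l \<in> spectrum M" using x(3) by (auto simp: spectrum_def ev)
  moreover have "finite (spectrum M)"
    by (rule card_finite_spectrum(1)[of _ "dim_row M"]) (simp add: M_def adjacency_matrix_def)
  ultimately have "max_eigenvalue G = l" unfolding max_eigenvalue_def M_def[symmetric]
    using x(4) by (intro Max_eqI) (auto simp: spectrum_def ev)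
  with that[of x] x show thesis by auto
qed

section \<open>From graphs to weights\<close>

lemma sum_adjacency:
  fixes G :: "'a graph"
  assumes "simple_graph G"
  shows "(\<Sum>u\<in>verts G. \<Sum>v\<in>verts G. of_bool ({u, v} \<in> edges G) :: real) = 2 * real (card (edges G))"
proof -
  let ?V = "verts G" and ?E = "edges G"
  have fin: "finite ?V" and E: "\<And>e. e \<in> ?E \<Longrightarrow> e \<subseteq> ?V \<and> card e = 2" using assms by (auto simp: simple_graph_def)
  have "finite ?E" by (rule finite_subset[of _ "Pow ?V"]) (use fin E in auto)
  have two: "card {(u, v). {u, v} = e} = 2" if e: "e \<in> ?E" for e
  proof -
    obtain p q where "e = {p, q}" "p \<noteq> q" using E[OF e] by (auto simp: card_2_iff)
    then have "{(u, v). {u, v} = e} = {(p, q), (q, p)}" by (auto simp: doubleton_eq_iff)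
    then show ?thesis using \<open>p \<noteq> q\<close> by simp
  qed
  have "(\<Sum>u\<in>?V. \<Sum>v\<in>?V. of_bool ({u, v} \<in> ?E) :: real) = (\<Sum>p\<in>?V \<times> ?V. of_bool ({fst p, snd p} \<in> ?E))"
    by (simp add: sum.cartesian_product case_prod_beta)
  also have "\<dots> = real (card {p \<in> ?V \<times> ?V. {fst p, snd p} \<in> ?E})"
    using fin by (simp add: sum_of_bool_eq[symmetric] of_bool_def sum.If_cases Int_def)
  also have "{p \<in> ?V \<times> ?V. {fst p, snd p} \<in> ?E} = (\<Union>e\<in>?E. {(u, v). {u, v} = e})"
    using E by fastforce
  also have "card \<dots> = (\<Sum>e\<in>?E. card {(u, v). {u, v} = e})"
    using \<open>finite ?E\<close> two by (intro card_UN_disjoint) (auto intro: card_ge_0_finite)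
  also have "\<dots> = 2 * card ?E" using two by simp
  finally show ?thesis by simp
qed

text \<open>An edge with \<open>r + 1\<close> common neighbours is the spine of a book: map \<open>0\<close> and \<open>1\<close> to its ends and the other
  vertices injectively to common neighbours.\<close>
lemma codegree_le:
  fixes G :: "'a graph"
  assumes G: "simple_graph G" and free: "free_of (book (r + 1)) G" and uv: "{u, v} \<in> edges G"
  shows "card {w \<in> verts G. {u, w} \<in> edges G \<and> {v, w} \<in> edges G} \<le> r"
proof (rule ccontr)
  let ?N = "{w \<in> verts G. {u, w} \<in> edges G \<and> {v, w} \<in> edges G}"
  assume "\<not> card ?N \<le> r"
  then have "card {2..<r + 3} \<le> card ?N" by simp
  moreover have "finite ?N" using G by (simp add: simple_graph_def)
  ultimately obtain g where g: "inj_on g {2..<r + 3}" "g ` {2..<r + 3} \<subseteq> ?N"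
    using card_le_inj[of "{2..<r + 3}" ?N] by auto
  define h where "h i = (if i = 0 then u else if i = 1 then v else g i)" for i :: nat
  have loop: "{w, w} \<notin> edges G" for w using G by (auto simp: simple_graph_def)
  have split: "{..<r + 1 + 2} = insert 0 (insert 1 {2..<r + 3})" by auto
  have gN: "g i \<in> ?N" if "2 \<le> i" "i < r + 3" for i using g(2) that by (meson atLeastLessThan_iff image_subset_iff)
  have inj: "inj_on h {..<r + 1 + 2}"
    unfolding split
  proof (intro inj_on_insert[THEN iffD2] conjI)
    show "inj_on h {2..<r + 3}" using g(1) by (auto simp: inj_on_def h_def)
    show "h 1 \<notin> h ` ({2..<r + 3} - {1})" using gN loop by (fastforce simp: h_def)
    show "h 0 \<notin> h ` (insert 1 {2..<r + 3} - {0})" using gN loop uv by (fastforce simp: h_def)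
  qed
  have "u \<in> verts G" "v \<in> verts G" using uv G by (auto simp: simple_graph_def)
  then have "h ` {..<r + 1 + 2} \<subseteq> verts G" unfolding split using gN by (auto simp: h_def)
  moreover have "h ` e \<in> edges G" if "e \<in> edges (book (r + 1))" for e
    using that uv gN by (auto simp: book_def h_def insert_commute)
  ultimately have "contains_copy G (book (r + 1))"
    unfolding contains_copy_def using inj by (intro exI[of _ h]) (auto simp: book_def)
  with free show False by (simp add: free_of_def)
qed

text \<open>The vector that is constant on each side, with squares inversely proportional to the sizes of the
  sides, and zero on isolated vertices is an eigenvector for the square root of the number of edges.\<close>
lemma complete_bipartite_eigenvalue:
  fixes G :: "'a graph"
  assumes G: "simple_graph G" and bip: "complete_bipartite (remove_isolated G)"
  shows "sqrt (card (edges G)) \<le> max_eigenvalue G"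
proof -
  from bip obtain A B where "A \<noteq> {} \<and> B \<noteq> {} \<and> A \<inter> B = {} \<and> verts (remove_isolated G) = A \<union> B \<and>
      edges (remove_isolated G) = {{p, q} | p q. p \<in> A \<and> q \<in> B}"
    unfolding complete_bipartite_def by (elim exE) (rule that)
  then have AB: "A \<noteq> {}" "B \<noteq> {}" "A \<inter> B = {}" and union: "verts (remove_isolated G) = A \<union> B"
    and "edges (remove_isolated G) = {{p, q} | p q. p \<in> A \<and> q \<in> B}"
    by (iprover elim: conjE)+
  then have E: "edges G = {{p, q} | p q. p \<in> A \<and> q \<in> B}" by (simp add: remove_isolated_def)
  let ?V = "verts G"
  have fin: "finite ?V" using G by (simp add: simple_graph_def)
  have "A \<union> B \<subseteq> ?V" unfolding union[symmetric] by (auto simp: remove_isolated_def)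
  then have sub: "A \<subseteq> ?V" "B \<subseteq> ?V" by auto
  then have finAB: "finite A" "finite B" using fin finite_subset by auto
  have adj: "{u, v} \<in> edges G \<longleftrightarrow> (u \<in> A \<and> v \<in> B) \<or> (u \<in> B \<and> v \<in> A)" for u v
    unfolding E by (auto simp: doubleton_eq_iff)
  have "edges G = (\<lambda>(p, q). {p, q}) ` (A \<times> B)" unfolding E by auto
  moreover have "inj_on (\<lambda>(p, q). {p, q}) (A \<times> B)"
    using AB(3) by (auto simp: inj_on_def doubleton_eq_iff)
  ultimately have card: "card (edges G) = card A * card B"
    by (simp add: card_image card_cartesian_product)
  define y where "y v = (if v \<in> A then sqrt (card B) else if v \<in> B then sqrt (card A) else 0)" for v
  have yB: "y v = sqrt (card A)" if "v \<in> B" for v using that AB(3) by (auto simp: y_def)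
  have yA: "y v = sqrt (card B)" if "v \<in> A" for v using that by (auto simp: y_def)
  have row: "(\<Sum>v\<in>?V. of_bool ({u, v} \<in> edges G) * y v) = sqrt (card (edges G)) * y u" if "u \<in> ?V" for u
  proof -
    consider "u \<in> A" | "u \<in> B" | "u \<notin> A" "u \<notin> B" by auto
    then show ?thesis
    proof cases
      case 1
      then have "{u, v} \<in> edges G \<longleftrightarrow> v \<in> B" for v using AB(3) by (auto simp: adj)
      then have "(\<Sum>v\<in>?V. of_bool ({u, v} \<in> edges G) * y v) = (\<Sum>v\<in>B. y v)"
        using sub fin by (simp add: of_bool_def if_distrib[of "\<lambda>c. c * _"] sum.If_cases Int_absorb1 cong: if_cong)
      then show ?thesis using 1 by (simp add: yB yA card real_sqrt_mult)
    next
      case 2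
      then have "{u, v} \<in> edges G \<longleftrightarrow> v \<in> A" for v using AB(3) by (auto simp: adj)
      then have "(\<Sum>v\<in>?V. of_bool ({u, v} \<in> edges G) * y v) = (\<Sum>v\<in>A. y v)"
        using sub fin by (simp add: of_bool_def if_distrib[of "\<lambda>c. c * _"] sum.If_cases Int_absorb1 cong: if_cong)
      then show ?thesis using 2 by (simp add: yB yA card real_sqrt_mult)
    next
      case 3
      then show ?thesis by (simp add: adj y_def)
    qed
  qed
  obtain p where p: "p \<in> A" using AB(1) by auto
  have "y p \<noteq> 0" using p finAB AB(2) by (simp add: yA)
  then have nz: "\<exists>u\<in>?V. y u \<noteq> 0" using p sub by auto
  have "?V \<noteq> {}" using p sub by auto
  then obtain x where "\<And>k y. \<exists>u\<in>?V. y u \<noteq> 0 \<Longrightarrow>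
      \<forall>u\<in>?V. (\<Sum>v\<in>?V. of_bool ({u, v} \<in> edges G) * y v) = k * y u \<Longrightarrow> k \<le> max_eigenvalue G"
    by (rule max_eigenvalue_perron[OF fin]) (rule that, assumption+)
  then show ?thesis using nz row by blast
qed

text \<open>Take any edge \<open>u v\<close>. Without triangles the neighbourhoods \<open>A\<close> of \<open>v\<close> and \<open>B\<close> of \<open>u\<close> are disjoint and
  independent, and they cover all non-isolated vertices as nothing is missed by \<open>u v\<close>. If \<open>p\<close>
  is in \<open>A\<close> and \<open>q\<close> in \<open>B\<close>, then the edge \<open>v p\<close> does not miss \<open>q\<close> either; as \<open>q\<close> is not in \<open>A\<close>, it must be
  adjacent to \<open>p\<close>.\<close>
lemma complete_bipartite_of_large_eigenvalue:
  fixes G :: "'a graph"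
  assumes G: "simple_graph G" and free: "free_of (book (r + 1)) G"
    and m: "card (edges G) = m" "1 \<le> m" "(4 * r)\<^sup>2 \<le> m" and le: "sqrt m \<le> max_eigenvalue G"
  shows "max_eigenvalue G = sqrt m" "complete_bipartite (remove_isolated G)"
proof -
  let ?V = "verts G" and ?adj = "\<lambda>u v. {u, v} \<in> edges G"
  have fin: "finite ?V" and edge: "\<And>e. e \<in> edges G \<Longrightarrow> e \<subseteq> ?V \<and> card e = 2"
    using G by (auto simp: simple_graph_def)
  have pair: "\<exists>p q. e = {p, q}" if "e \<in> edges G" for e
    using edge[OF that] by (auto simp: card_2_iff)
  have "edges G \<noteq> {}" using m by auto
  then obtain e where e: "e \<in> edges G" by auto
  then obtain u v where "e = {u, v}" using pair by blast
  with e have uv: "{u, v} \<in> edges G" by simp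
  have inV: "p \<in> ?V" "q \<in> ?V" if "{p, q} \<in> edges G" for p q using edge[OF that] by auto
  have ne: "?V \<noteq> {}" using inV[OF uv] by auto
  obtain x0 where x0: "\<And>u. 0 \<le> x0 u" "(\<Sum>u\<in>?V. (x0 u)\<^sup>2) = 1"
    "\<And>u. u \<in> ?V \<Longrightarrow> (\<Sum>v\<in>?V. of_bool (?adj u v) * x0 v) = max_eigenvalue G * x0 u"
    by (rule max_eigenvalue_perron[OF fin ne]) (rule that, assumption+)
  define n where "n = sqrt m"
  have n: "0 < n" "n\<^sup>2 = m" using m by (auto simp: n_def)
  have r: "4 * real r \<le> n" unfolding n_def using m(3) by (intro real_le_rsqrt) (metis of_nat_le_iff of_nat_mult of_nat_numeral of_nat_power)
  define x where "x u = sqrt (2 * n) * x0 u" for u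
  interpret principal_eigenvector ?V ?adj x n "max_eigenvalue G"
  proof
    show "(\<Sum>u\<in>?V. (x u)\<^sup>2) = 2 * n" using n x0(2)
      by (simp add: x_def power_mult_distrib sum_distrib_left[symmetric])
    show "(\<Sum>v\<in>?V. of_bool (?adj u v) * x v) = max_eigenvalue G * x u" if "u \<in> ?V" for u
    proof -
      have "(\<Sum>v\<in>?V. of_bool (?adj u v) * x v) = sqrt (2 * n) * (\<Sum>v\<in>?V. of_bool (?adj u v) * x0 v)"
        by (simp add: x_def sum_distrib_left mult_ac)
      then show ?thesis using x0(3)[OF that] by (simp add: x_def)
    qed
    show "(\<Sum>u\<in>?V. \<Sum>v\<in>?V. of_bool (?adj u v)) = 2 * n\<^sup>2" using sum_adjacency[OF G] by (simp add: n m)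
    show "4 * (\<Sum>w\<in>?V. of_bool (?adj u w) * of_bool (?adj v w)) \<le> n" if "?adj u v" for u v
    proof -
      have "(\<Sum>w\<in>?V. of_bool (?adj u w) * of_bool (?adj v w) :: real) = (\<Sum>w\<in>?V. of_bool (?adj u w \<and> ?adj v w))"
        by (intro sum.cong) auto
      also have "\<dots> = real (card {w \<in> ?V. ?adj u w \<and> ?adj v w})"
        using fin by (simp add: of_bool_def sum.If_cases Int_def)
      also have "\<dots> \<le> real r" using codegree_le[OF G free that] by simp
      finally show ?thesis using r by simp
    qed
  qed (use fin n le x0(1) in \<open>auto simp: n_def x_def insert_commute\<close>)
  show "max_eigenvalue G = sqrt m" using eigenvalue_eq by (simp add: n_def)
  have tf: False if "{p, q} \<in> edges G" "{p, s} \<in> edges G" "{q, s} \<in> edges G" for p q s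
    using triangle_free[of p q s] that inV by blast
  have dom: "{p, z} \<in> edges G \<or> {q, z} \<in> edges G" if "{p, q} \<in> edges G" "{z, z'} \<in> edges G" for p q z z'
  proof -
    have "x z * x z' = 1" using edge_extremal(1) inV that(2) by blast
    then have "x z \<noteq> 0" by auto
    then show ?thesis using edge_reaches_support[of p q z] inV that by blast
  qed
  define A where "A = {z. {v, z} \<in> edges G}"
  define B where "B = {z. {u, z} \<in> edges G}"
  have AB: "z \<in> A \<or> z \<in> B" if "{z, z'} \<in> edges G" for z z' using dom[OF uv that] by (auto simp: A_def B_def)
  have disj: "A \<inter> B = {}" using tf[OF uv] by (auto simp: A_def B_def)
  have join: "{p, q} \<in> edges G" if "p \<in> A" "q \<in> B" for p q
  proof -
    have "{v, p} \<in> edges G" "{q, u} \<in> edges G" using that by (auto simp: A_def B_def insert_commute)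
    from dom[OF this] show ?thesis using that disj by (auto simp: A_def)
  qed
  have "edges G = {{p, q} | p q. p \<in> A \<and> q \<in> B}"
  proof (intro equalityI subsetI)
    fix e assume e: "e \<in> edges G"
    then obtain p q where pq: "e = {p, q}" using pair by blast
    have "{p, q} \<in> edges G" "{q, p} \<in> edges G" using e by (simp_all add: pq insert_commute)
    note AB[OF this(1)] AB[OF this(2)]
    moreover have "\<not> (p \<in> A \<and> q \<in> A)" "\<not> (p \<in> B \<and> q \<in> B)"
      using tf[of _ p q] \<open>{p, q} \<in> edges G\<close> unfolding A_def B_def by blast+
    ultimately show "e \<in> {{p, q} | p q. p \<in> A \<and> q \<in> B}" unfolding pq by blast
  qed (use join in auto)
  moreover have "{z \<in> ?V. \<exists>e\<in>edges G. z \<in> e} = A \<union> B"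
  proof (intro equalityI subsetI)
    fix z assume "z \<in> {z \<in> ?V. \<exists>e\<in>edges G. z \<in> e}"
    then obtain e where e: "e \<in> edges G" "z \<in> e" by blast
    then obtain p q where pq: "e = {p, q}" using pair by blast
    have "{p, q} \<in> edges G" "{q, p} \<in> edges G" using e by (simp_all add: pq insert_commute)
    note AB[OF this(1)] AB[OF this(2)]
    then show "z \<in> A \<union> B" using e(2) pq by blast
  next
    fix z assume "z \<in> A \<union> B"
    then obtain p where "{p, z} \<in> edges G" unfolding A_def B_def by blast
    then show "z \<in> {z \<in> ?V. \<exists>e\<in>edges G. z \<in> e}" using inV by blast
  qed
  moreover have "u \<in> A" "v \<in> B" using uv by (auto simp: A_def B_def insert_commute)
  ultimately show "complete_bipartite (remove_isolated G)"
    unfolding complete_bipartite_def remove_isolated_def fst_conv snd_conv using disj by blast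
qed

theorem theorem1p8:
  fixes G :: "'a graph" and r m :: nat
  assumes "simple_graph G"
    and "free_of (book (r + 1)) G"
    and "card (edges G) = m"
    and "m \<ge> 1"
    and "m \<ge> (4 * r)\<^sup>2"
  shows "max_eigenvalue G \<le> sqrt (real m) \<and>
    (max_eigenvalue G = sqrt (real m) \<longleftrightarrow> complete_bipartite (remove_isolated G))"
proof -
  note large = complete_bipartite_of_large_eigenvalue[OF assms]
  have "max_eigenvalue G \<le> sqrt m" using large(1) by linarith
  moreover have "complete_bipartite (remove_isolated G)" if "max_eigenvalue G = sqrt m"
    using large(2) that by simp
  moreover have "sqrt m \<le> max_eigenvalue G" if "complete_bipartite (remove_isolated G)"
    using complete_bipartite_eigenvalue[OF assms(1) that] assms(3) by simp
  ultimately show ?thesis by (meson antisym)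
qed

end
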